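(* Let $X_1,X_2,\ldots$ be independent identically distributed random variables with $\mathsf{E}X_1=0$ and $0<\mathsf{E}X_1^2=\sigma^2<\infty$ ($\sigma>0$). For each $n\in\mathbb{N}$ let $\Lambda_n$ be a positive random variable and let $N_n^\star$ be a random variable, independent of the sequence $X_1,X_2,\ldots$, having the mixed Poisson distribution $$\mathsf{P}(N_n^\star=k)=\int_0^\infty e^{-\lambda}\frac{\lambda^k}{k!}\,d\mathsf{P}(\Lambda_n<\lambda),\qquad k\in\mathbb{N}\cup\{0\}.$$ Let $S_{N_n^\star}=X_1+\ldots+X_{N_n^\star}$ (equal to $0$ if $N_n^\star=0$). If $\mathsf{E}\Lambda_n<\infty$, then $$\sup_{z\ge 0}\bigg|Q_{S_{N_n^\star}}(z)-\int_0^\infty\Phi_0\Big(\frac{z}{2\sigma\sqrt{\lambda\,\mathsf{E}\Lambda_n}}\Big)\,d\mathsf{P}\big(\Lambda_n<\lambda\,\mathsf{E}\Lambda_n\big)\bigg|\le\frac{7.4184}{\sigma^2}\,\mathsf{E}X_1^2G_n(X_1)$$ $$=\frac{7.4184}{\sigma^2}\,\mathsf{E}X_1^2\min\bigg\{1,\,\frac{|X_1|}{\sigma\sqrt{\Lambda_n}}\bigg\}=\frac{7.4184}{\sigma^2}\bigg[\mathsf{E}X_1^2\,\mathbb{I}\big(|X_1|\ge\sigma\sqrt{\Lambda_n}\big)+\mathsf{E}\frac{|X_1|^3}{\sigma\sqrt{\Lambda_n}}\,\mathbb{I}\big(|X_1|<\sigma\sqrt{\Lambda_n}\big)\bigg],$$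 where in the last two expressions the random variables $X_1$ and $\Lambda_n$ are assumed independent.
   Context: The concentration function of a random variable $\xi$ is $Q_\xi(z)=\sup_{x\in\mathbb{R}}\mathsf{P}(x\le\xi\le x+z)$, $z\ge 0$. $\Phi$ is the standard normal distribution function, and the folded normal distribution function is $\Phi_0(x)=2\Phi(x)-1$ for $x\ge 0$, $\Phi_0(x)=0$ for $x<0$. $\mathbb{I}(A)$ is the indicator of the event $A$. For $x\in\mathbb{R}$, $$G_n(x)=\mathsf{E}\min\Big\{1,\,\frac{|x|}{\sigma\sqrt{\Lambda_n}}\Big\}.$$ The integrator $d\mathsf{P}(\Lambda_n<\lambda\,\mathsf{E}\Lambda_n)$ denotes integration in $\lambda$ with respect to the distribution of $\Lambda_n/\mathsf{E}\Lambda_n$. *)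

theory Defs
  imports "HOL-Probability.Probability"
begin

definition concentration_fun :: "'a measure \<Rightarrow> ('a \<Rightarrow> real) \<Rightarrow> real \<Rightarrow> real" where
  "concentration_fun M \<xi> z = (SUP x. measure M {\<omega> \<in> space M. x \<le> \<xi> \<omega> \<and> \<xi> \<omega> \<le> x + z})"

definition std_normal_cdf :: "real \<Rightarrow> real" where
  "std_normal_cdf = cdf std_normal_distribution"

definition folded_normal_cdf :: "real \<Rightarrow> real" where
  "folded_normal_cdf x = (if x \<ge> 0 then 2 * std_normal_cdf x - 1 else 0)"

definition mixed_poisson :: "'a measure \<Rightarrow> ('a \<Rightarrow> nat) \<Rightarrow> ('a \<Rightarrow> real) \<Rightarrow> bool" where
  "mixed_poisson M N L \<longleftrightarrow>
     N \<in> measurable M (count_space UNIV) \<and>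
     (\<forall>k. measure M {\<omega> \<in> space M. N \<omega> = k} =
        (LINT l:{0<..}|distr M borel L. exp (- l) * l ^ k / fact k))"

text \<open>The library's indep_var requires both variables to have the same value type; this is the
  right-hand side of indep_var_eq without that restriction.\<close>

definition indep_var_het ::
  "'a measure \<Rightarrow> 'b measure \<Rightarrow> ('a \<Rightarrow> 'b) \<Rightarrow> 'c measure \<Rightarrow> ('a \<Rightarrow> 'c) \<Rightarrow> bool" where
  "indep_var_het M S A T B \<longleftrightarrow>
     A \<in> measurable M S \<and> B \<in> measurable M T \<and>
     prob_space.indep_set M
       (sigma_sets (space M) {A -` C \<inter> space M | C. C \<in> sets S})
       (sigma_sets (space M) {B -` C \<inter> space M | C. C \<in> sets T})"

definition random_sum :: "(nat \<Rightarrow> 'a \<Rightarrow> real) \<Rightarrow> ('a \<Rightarrow> nat) \<Rightarrow> 'a \<Rightarrow> real" where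
  "random_sum X N \<omega> = (\<Sum>i=1..N \<omega>. X i \<omega>)"

definition trunc_mean :: "'a measure \<Rightarrow> real \<Rightarrow> ('a \<Rightarrow> real) \<Rightarrow> real \<Rightarrow> real" where
  "trunc_mean M \<sigma> L x = (\<integral>\<omega>. min 1 (\<bar>x\<bar> / (\<sigma> * sqrt (L \<omega>))) \<partial>M)"

text \<open>The mean of f(A, B) computed as if A and B were independent, i.e. under the product
  of their marginal laws; A and B themselves need not be independent on M.\<close>

definition indep_mean ::
  "'a measure \<Rightarrow> ('a \<Rightarrow> real) \<Rightarrow> ('a \<Rightarrow> real) \<Rightarrow> (real \<Rightarrow> real \<Rightarrow> real) \<Rightarrow> real" where
  "indep_mean M A B f = (\<integral>p. f (fst p) (snd p) \<partial>(distr M borel A \<Otimes>\<^sub>M distr M borel B))"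

end

theory Submission
  imports Defs
begin

text \<open>
  Conditionally on \<open>\<Lambda> = l\<close> the sum is compound Poisson, and for such sums Stein's method needs no
  leave-one-out argument: with \<open>\<xi> = X\<^sub>1 / (\<sigma> \<surd>l)\<close>, the normalised sum \<open>W\<close> and an independent \<open>\<xi>\<close> satisfy the
  exact identity \<open>E W f(W) = l E \<xi> f(W + \<xi>)\<close> (size bias of the Poisson law). Put
  \<open>\<gamma> = l E \<xi>\<^sup>2 min(1, |\<xi>|)\<close>. A clipped linear \<open>f\<close> gives the concentration inequality
  \<open>P(a \<le> W \<le> b) \<le> b - a + \<gamma>\<close> for \<open>\<gamma> \<le> 1/2\<close>. The solution \<open>f\<close> of Stein's equation for \<open>[a, b]\<close> satisfies
  \<open>|f| \<le> \<surd>2\<close> and \<open>|f'| \<le> 2\<close>, so its first order Taylor remainder, with the jumps of \<open>f'\<close> at \<open>a\<close> and \<open>b\<close>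
  controlled by the concentration inequality, yields \<open>|P(a \<le> W \<le> b) - (\<Phi>(b) - \<Phi>(a))| \<le> (6 + \<surd>2) \<gamma>\<close>,
  and \<open>6 + \<surd>2 < 7.4184\<close>. It remains to integrate over the law of \<open>\<Lambda>\<close>: among all intervals of length \<open>z\<close>,
  the one centred at \<open>0\<close> has the largest probability under every centred normal law
  simultaneously, so the concentration function of the limiting mixture is the mixture of the
  folded normal distribution functions.
\<close>

subsection \<open>The normal distribution function\<close>

abbreviation "std_Phi \<equiv> cdf std_normal_distribution"

lemma std_normal_density_pos: "std_normal_density x > 0"
  by (simp add: std_normal_density_def)

lemma std_normal_density_mono:
  "\<bar>x\<bar> \<le> \<bar>y\<bar> \<Longrightarrow> std_normal_density y \<le> std_normal_density x"
  using abs_le_square_iff[of x y] by (simp add: std_normal_density_def divide_right_mono)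

lemma integrable_std_normal_density: "integrable lborel std_normal_density"
  using integrable_std_normal_moment[of 0] by simp

lemma measure_std_normal:
  assumes [measurable]: "A \<in> sets borel"
  shows "measure std_normal_distribution A = (LINT x:A|lborel. std_normal_density x)"
proof -
  have "emeasure std_normal_distribution A = (\<integral>\<^sup>+ x. ennreal (indicator A x * std_normal_density x) \<partial>lborel)"
    by (subst emeasure_density) (auto intro!: nn_integral_cong split: split_indicator)
  also have "\<dots> = ennreal (\<integral> x. indicator A x * std_normal_density x \<partial>lborel)"
    by (rule nn_integral_eq_integral)
      (auto intro!: Bochner_Integration.integrable_bound[OF integrable_std_normal_density] split: split_indicator)
  finally show ?thesis
    by (simp add: measure_def set_lebesgue_integral_def integral_nonneg_AE)
qed

lemma std_Phi_diff:
  assumes "x \<le> y"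
  shows "std_Phi y - std_Phi x = integral {x..y} std_normal_density"
proof -
  interpret real_distribution std_normal_distribution by (rule real_dist_normal_dist)
  have i: "set_integrable lborel {x..y} std_normal_density"
    unfolding set_integrable_def
    by (auto intro!: Bochner_Integration.integrable_bound[OF integrable_std_normal_density] split: split_indicator)
  have "std_Phi y - std_Phi x = measure std_normal_distribution {x<..y}"
    using assms cdf_diff_eq[of x y] by (cases "x = y") auto
  also have "\<dots> = (LINT u:{x<..y}|lborel. std_normal_density u)"
    by (rule measure_std_normal) simp
  also have "\<dots> = (LINT u:{x..y}|lborel. std_normal_density u)"
    unfolding set_lebesgue_integral_def
    by (intro integral_cong_AE) (auto intro!: AE_I[where N="{x}"] split: split_indicator_asm simp: indicator_def)
  also have "\<dots> = integral {x..y} std_normal_density"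
    by (rule set_borel_integral_eq_integral(2)[OF i])
  finally show ?thesis .
qed

lemma continuous_std_normal_density: "continuous_on A std_normal_density"
  unfolding std_normal_density_def[abs_def] by (intro continuous_intros) auto

text \<open>Near \<open>x\<close> the distribution function is a constant plus an integral with the
  fixed lower endpoint \<open>x - 1\<close>, so the fundamental theorem of calculus applies.\<close>

lemma DERIV_std_Phi: "(std_Phi has_real_derivative std_normal_density x) (at x)"
proof -
  let ?a = "x - 1" and ?b = "x + 1"
  have "((\<lambda>u. integral {?a..u} std_normal_density) has_real_derivative std_normal_density x) (at x within {?a..?b})"
    by (rule integral_has_real_derivative) (auto intro: continuous_std_normal_density)
  then have "((\<lambda>u. std_Phi ?a + integral {?a..u} std_normal_density) has_real_derivative std_normal_density x) (at x within {?a..?b})"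
    by (auto intro!: derivative_eq_intros)
  then have "((\<lambda>u. std_Phi ?a + integral {?a..u} std_normal_density) has_real_derivative std_normal_density x) (at x)"
    by (subst (asm) at_within_interior) auto
  then show ?thesis
    by (rule DERIV_cong_ev[OF refl _ refl, THEN iffD1, rotated])
      (auto intro!: eventually_nhds_in_open[of "{?a<..<?b}", THEN eventually_mono] simp: std_Phi_diff[symmetric])
qed

lemma DERIV_std_normal_density:
  "(std_normal_density has_real_derivative - x * std_normal_density x) (at x)"
  unfolding std_normal_density_def[abs_def]
  by (auto intro!: derivative_eq_intros simp: divide_simps)

lemma std_Phi_mono: "x \<le> y \<Longrightarrow> std_Phi x \<le> std_Phi y"
proof -
  interpret real_distribution std_normal_distribution by (rule real_dist_normal_dist)
  show "x \<le> y \<Longrightarrow> std_Phi x \<le> std_Phi y" by (rule cdf_nondecreasing)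
qed

lemma std_Phi_bounds: "0 \<le> std_Phi x" "std_Phi x \<le> 1"
proof -
  interpret real_distribution std_normal_distribution by (rule real_dist_normal_dist)
  show "0 \<le> std_Phi x" "std_Phi x \<le> 1" by (rule cdf_nonneg cdf_bounded_prob)+
qed

lemma std_Phi_at_top: "(std_Phi \<longlongrightarrow> 1) at_top"
proof -
  interpret real_distribution std_normal_distribution by (rule real_dist_normal_dist)
  show ?thesis by (rule cdf_lim_at_top_prob)
qed

lemma std_Phi_at_bot: "(std_Phi \<longlongrightarrow> 0) at_bot"
proof -
  interpret real_distribution std_normal_distribution by (rule real_dist_normal_dist)
  show ?thesis by (rule cdf_lim_at_bot)
qed

text \<open>The density is even, so \<open>std_Phi u + std_Phi (- u)\<close> has derivative zero;
  its limit at infinity identifies the constant as 1.\<close>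

lemma std_Phi_minus: "std_Phi (- x) = 1 - std_Phi x"
proof -
  define g where "g u = std_Phi u + std_Phi (- u)" for u
  have "(g has_real_derivative 0) (at u)" for u
    unfolding g_def
    by (rule derivative_eq_intros DERIV_std_Phi DERIV_chain2[OF DERIV_std_Phi] refl)+
      (simp add: std_normal_density_def)
  then have g: "g u = g 0" for u
    by (rule DERIV_isconst_all[rule_format, of g u 0]) 
  have "(g \<longlongrightarrow> 1 + 0) at_top"
    unfolding g_def
    by (intro tendsto_add std_Phi_at_top filterlim_compose[OF std_Phi_at_bot] filterlim_uminus_at_bot_at_top)
  moreover have "g = (\<lambda>_. g 0)" using g by blast
  ultimately have "((\<lambda>_::real. g 0) \<longlongrightarrow> 1) at_top" by (metis add_0_right)
  then have "g 0 = 1" by (simp add: tendsto_const_iff)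
  with g[of x] show ?thesis by (simp add: g_def)
qed

text \<open>The gap \<open>U\<close> between density over \<open>u\<close> and tail probability has
  negative derivative and tends to 0 at infinity, hence it is positive on the whole positive
  half-line.\<close>

lemma mills_ratio:
  assumes "w > 0"
  shows "w * (1 - std_Phi w) \<le> std_normal_density w"
proof -
  define U where "U u = std_normal_density u / u - (1 - std_Phi u)" for u
  have deriv: "(U has_real_derivative - std_normal_density u / u\<^sup>2) (at u)" if "u > 0" for u
    unfolding U_def using that
    by (auto intro!: derivative_eq_intros DERIV_std_Phi DERIV_std_normal_density
        simp: field_simps power2_eq_square)
  have lim: "(U \<longlongrightarrow> 0 - (1 - 1)) at_top"
    unfolding U_def
  proof (intro tendsto_intros std_Phi_at_top)
    show "((\<lambda>u. std_normal_density u / u) \<longlongrightarrow> 0) at_top"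
    proof (rule Lim_null_comparison[where g="\<lambda>u. std_normal_density 0 / u"])
      show "\<forall>\<^sub>F u in at_top. norm (std_normal_density u / u) \<le> std_normal_density 0 / u"
        using eventually_gt_at_top[of 0]
        by eventually_elim (auto intro!: divide_right_mono std_normal_density_mono )
    qed real_asymp
  qed
  have "0 < U w"
  proof (intro DERIV_neg_imp_decreasing_at_top[of w U 0])
    fix u assume "w \<le> u"
    with assms have "u > 0" by simp
    with deriv show "\<exists>y. (U has_real_derivative y) (at u) \<and> y < 0"
      by (intro exI[of _ "- std_normal_density u / u\<^sup>2"] conjI divide_neg_pos)
        (simp_all add: std_normal_density_pos)
  qed (use lim in simp)
  then show ?thesis using assms by (simp add: U_def field_simps)
qed

lemma std_Phi_0: "std_Phi 0 = 1 / 2"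
  using std_Phi_minus[of 0] by simp

text \<open>The derivative of the left side has the sign of
  \<open>u * (1 - std_Phi u) - std_normal_density u\<close>, which Mills' inequality makes
  nonpositive; the maximum is therefore the value at 0.\<close>

lemma std_normal_tail_bound:
  assumes "w \<ge> 0"
  shows "exp (w\<^sup>2 / 2) * (1 - std_Phi w) \<le> 1 / 2"
proof -
  let ?V = "\<lambda>u. exp (u\<^sup>2 / 2) * (1 - std_Phi u)"
  have "?V w \<le> ?V 0"
  proof (rule DERIV_nonpos_imp_nonincreasing[OF assms])
    fix u :: real assume "0 \<le> u" "u \<le> w"
    have "u * (1 - std_Phi u) \<le> std_normal_density u"
      using mills_ratio[of u] \<open>0 \<le> u\<close> std_normal_density_pos[of u] by (cases "u = 0") auto
    then have "exp (u\<^sup>2 / 2) * (u * (1 - std_Phi u) - std_normal_density u) \<le> 0"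
      by (intro mult_nonneg_nonpos) auto
    moreover have "(?V has_real_derivative exp (u\<^sup>2 / 2) * (u * (1 - std_Phi u) - std_normal_density u)) (at u)"
      by (auto intro!: derivative_eq_intros DERIV_std_Phi simp: algebra_simps)
    ultimately show "\<exists>y. (?V has_real_derivative y) (at u) \<and> y \<le> 0" by blast
  qed
  then show ?thesis by (simp add: std_Phi_0)
qed

text \<open>As a function of its midpoint, the mass of an interval of length \<open>z\<close> is
  even, and it decreases as the midpoint moves right from 0, because the density at the right end is
  then the smaller one. So midpoint 0 is optimal.\<close>

lemma std_normal_interval_le:
  assumes "z \<ge> 0"
  shows "std_Phi (x + z) - std_Phi x \<le> 2 * std_Phi (z / 2) - 1"
proof -
  let ?g = "\<lambda>u. std_Phi (u + z / 2) - std_Phi (u - z / 2)"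
  have sym: "?g (- u) = ?g u" for u
    using std_Phi_minus[of "u + z / 2"] std_Phi_minus[of "u - z / 2"] by (simp add: algebra_simps)
  have der: "(?g has_real_derivative std_normal_density (u + z / 2) - std_normal_density (u - z / 2)) (at u)" for u
    by (auto intro!: derivative_eq_intros DERIV_chain2[OF DERIV_std_Phi])
  have "?g u \<le> ?g 0" if "u \<ge> 0" for u
  proof (rule DERIV_nonpos_imp_nonincreasing[OF that])
    fix v :: real assume "0 \<le> v" "v \<le> u"
    have "std_normal_density (v + z / 2) \<le> std_normal_density (v - z / 2)"
      using \<open>0 \<le> v\<close> assms by (intro std_normal_density_mono) auto
    then show "\<exists>y. (?g has_real_derivative y) (at v) \<and> y \<le> 0" using der by force
  qed
  \<comment> \<open>The interval from \<open>x\<close> to \<open>x + z\<close> has midpoint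
    \<open>x + z / 2\<close>.\<close>
  then have "?g \<bar>x + z / 2\<bar> \<le> ?g 0" by simp
  then have "?g (x + z / 2) \<le> ?g 0" using sym[of "x + z / 2"] by (cases "x + z / 2 \<ge> 0") auto
  moreover have "std_Phi (z / 2) - std_Phi (- (z / 2)) = 2 * std_Phi (z / 2) - 1"
    unfolding std_Phi_minus by simp
  ultimately show ?thesis by (simp add: add.commute)
qed


lemma continuous_on_std_Phi [continuous_intros]:
  "continuous_on A f \<Longrightarrow> continuous_on A (\<lambda>x. std_Phi (f x))"
  by (rule continuous_on_compose2[of UNIV std_Phi])
    (auto intro!: continuous_at_imp_continuous_on DERIV_isCont[OF DERIV_std_Phi])

lemma borel_measurable_std_Phi [measurable]: "std_Phi \<in> borel_measurable borel"
  by (intro borel_measurable_continuous_onI continuous_on_std_Phi continuous_on_id)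

subsection \<open>Stein's equation for an interval\<close>

text \<open>The bounded solution of \<open>f' w - w * f w = indicator {a..b} w - (std_Phi b -
  std_Phi a)\<close>: the integral of the right side against the normal density up to
  \<open>w\<close>, divided by the density at \<open>w\<close>. Clipping \<open>w\<close> to the
  interval merges the cases left of, inside and right of it.\<close>

definition stein_sol :: "real \<Rightarrow> real \<Rightarrow> real \<Rightarrow> real" where
  "stein_sol a b w = sqrt (2 * pi) * exp (w\<^sup>2 / 2) *
     (std_Phi (max a (min b w)) - std_Phi a - (std_Phi b - std_Phi a) * std_Phi w)"

text \<open>The derivative of \<^term>\<open>stein_sol a b\<close>, extended to the two kinks \<open>a\<close> and \<open>b\<close> by Stein's equation.\<close>

definition stein_sol' :: "real \<Rightarrow> real \<Rightarrow> real \<Rightarrow> real" where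
  "stein_sol' a b w = w * stein_sol a b w + indicator {a..b} w - (std_Phi b - std_Phi a)"

lemma continuous_stein_sol: "continuous_on A (stein_sol a b)"
  unfolding stein_sol_def[abs_def] by (intro continuous_intros) auto

lemma borel_measurable_stein_sol [measurable]: "stein_sol a b \<in> borel_measurable borel"
  by (intro borel_measurable_continuous_onI continuous_stein_sol)

lemma borel_measurable_stein_sol' [measurable]: "stein_sol' a b \<in> borel_measurable borel"
  unfolding stein_sol'_def[abs_def] by measurable

lemma sqrt_exp_std_normal_density: "sqrt (2 * pi) * exp (w\<^sup>2 / 2) * std_normal_density w = 1"
  by (simp add: std_normal_density_def exp_minus field_simps)

lemma DERIV_stein_sol:
  assumes "a \<le> b" "w \<noteq> a" "w \<noteq> b"
  shows "(stein_sol a b has_real_derivative stein_sol' a b w) (at w)"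
proof -
  \<comment> \<open>Away from the kinks, \<open>h\<close> is the slope of the clipping map: 1 inside
    the interval, 0 outside.\<close>
  define h :: real where "h = indicator {a..b} w"
  have "((\<lambda>u. std_Phi (max a (min b u))) has_real_derivative h * std_normal_density w) (at w)"
  proof -
    consider "w < a" | "a < w" "w < b" | "b < w" using assms by linarith
    then show ?thesis
    proof cases
      case 1
      have "((\<lambda>u. std_Phi a) has_real_derivative h * std_normal_density w) (at w)"
        using 1 by (simp add: h_def)
      then show ?thesis
        by (rule has_field_derivative_transform_within_open[of _ _ _ "{..<a}"]) (use 1 assms in auto)
    next
      case 2
      have "(std_Phi has_real_derivative h * std_normal_density w) (at w)"
        using 2 DERIV_std_Phi by (simp add: h_def)
      then show ?thesis
        by (rule has_field_derivative_transform_within_open[of _ _ _ "{a<..<b}"]) (use 2 in auto)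
    next
      case 3
      have "((\<lambda>u. std_Phi b) has_real_derivative h * std_normal_density w) (at w)"
        using 3 by (simp add: h_def)
      then show ?thesis
        by (rule has_field_derivative_transform_within_open[of _ _ _ "{b<..}"]) (use 3 assms in auto)
    qed
  qed
  note D = this
  have "(stein_sol a b has_real_derivative
      sqrt (2 * pi) * (exp (w\<^sup>2 / 2) * w) *
        (std_Phi (max a (min b w)) - std_Phi a - (std_Phi b - std_Phi a) * std_Phi w)
      + sqrt (2 * pi) * exp (w\<^sup>2 / 2) *
        (h * std_normal_density w - (std_Phi b - std_Phi a) * std_normal_density w)) (at w)"
    unfolding stein_sol_def[abs_def]
    by (rule derivative_eq_intros D DERIV_std_Phi refl | simp)+
  also have "sqrt (2 * pi) * (exp (w\<^sup>2 / 2) * w) *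
        (std_Phi (max a (min b w)) - std_Phi a - (std_Phi b - std_Phi a) * std_Phi w)
      + sqrt (2 * pi) * exp (w\<^sup>2 / 2) *
        (h * std_normal_density w - (std_Phi b - std_Phi a) * std_normal_density w)
    = w * stein_sol a b w + (sqrt (2 * pi) * exp (w\<^sup>2 / 2) * std_normal_density w) * (h - (std_Phi b - std_Phi a))"
    unfolding stein_sol_def by (simp add: algebra_simps)
  finally show ?thesis
    unfolding sqrt_exp_std_normal_density by (simp add: stein_sol'_def h_def add_diff_eq)
qed

text \<open>With Z standard normal, \<open>K\<close> is the probability that Z lies in the interval
  and is at most \<open>w\<close>. The four bounds on \<open>K\<close> are the Frechet bounds for
  two events of probabilities \<open>B - A\<close> and \<open>P\<close>; they keep \<open>K\<close>
  within both \<open>P\<close> and \<open>1 - P\<close> of the product.\<close>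

lemma stein_sol_kernel_bound:
  assumes "a \<le> b"
  shows "\<bar>std_Phi (max a (min b w)) - std_Phi a - (std_Phi b - std_Phi a) * std_Phi w\<bar>
    \<le> 1 - std_Phi \<bar>w\<bar>"
proof -
  define A B P where "A = std_Phi a" and "B = std_Phi b" and "P = std_Phi w"
  have ab: "0 \<le> A" "A \<le> B" "B \<le> 1" "0 \<le> P" "P \<le> 1"
    using std_Phi_bounds std_Phi_mono assms by (auto simp: A_def B_def P_def)
  define K where "K = std_Phi (max a (min b w)) - A"
  have K: "0 \<le> K" "K \<le> B - A" "K \<le> P" "B - A - (1 - P) \<le> K"
  proof -
    consider "w < a" | "a \<le> w" "w \<le> b" | "b < w" by linarith
    then have "0 \<le> K \<and> K \<le> B - A \<and> K \<le> P \<and> B - A - (1 - P) \<le> K"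
    proof cases
      case 1
      then have "K = 0" "P \<le> A" using assms std_Phi_mono[of w a] by (auto simp: K_def A_def P_def)
      with ab show ?thesis by auto
    next
      case 2
      then have "K = P - A" "A \<le> P" "P \<le> B" using std_Phi_mono by (auto simp: K_def A_def P_def B_def)
      with ab show ?thesis by auto
    next
      case 3
      then have "K = B - A" "B \<le> P" using assms std_Phi_mono[of b w] by (auto simp: K_def A_def P_def B_def)
      with ab show ?thesis by auto
    qed
    then show "0 \<le> K" "K \<le> B - A" "K \<le> P" "B - A - (1 - P) \<le> K" by auto
  qed
  have m: "(B - A) * P \<le> P" "0 \<le> (B - A) * P" "(B - A) * (1 - P) \<le> 1 - P" "0 \<le> (B - A) * (1 - P)"
    using ab by (auto intro: mult_left_le_one_le)
  have c: "(B - A) * (1 - P) = B - A - (B - A) * P" by (simp add: algebra_simps)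
  have "\<bar>K - (B - A) * P\<bar> \<le> P" using m(1,2) K ab by arith
  moreover have "\<bar>K - (B - A) * P\<bar> \<le> 1 - P" using m(3,4) K ab unfolding c by arith
  \<comment> \<open>The right side is the smaller of \<open>P\<close> and \<open>1 - P\<close>; the
    sign of \<open>w\<close> decides which.\<close>
  moreover have "1 - std_Phi \<bar>w\<bar> = (if w \<ge> 0 then 1 - P else P)"
    using std_Phi_minus[of w] by (auto simp: P_def)
  ultimately show ?thesis unfolding K_def A_def B_def P_def by auto
qed

lemma stein_sol_bound:
  assumes "a \<le> b"
  shows "\<bar>stein_sol a b w\<bar> \<le> sqrt 2"
proof -
  have "\<bar>stein_sol a b w\<bar> \<le> sqrt (2 * pi) * exp (w\<^sup>2 / 2) * (1 - std_Phi \<bar>w\<bar>)"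
    unfolding stein_sol_def abs_mult using stein_sol_kernel_bound[OF assms] by (auto intro!: mult_mono)
  also have "\<dots> = sqrt (2 * pi) * (exp (\<bar>w\<bar>\<^sup>2 / 2) * (1 - std_Phi \<bar>w\<bar>))" by simp
  \<comment> \<open>Estimating \<open>pi\<close> by 4 turns \<open>sqrt (2 * pi) / 2\<close> into
    \<open>sqrt 2\<close>.\<close>
  also have "\<dots> \<le> sqrt (2 * 4) * (1 / 2)"
    using std_normal_tail_bound[of "\<bar>w\<bar>"] pi_less_4 std_Phi_bounds
    by (intro mult_mono real_sqrt_le_mono) auto
  also have "\<dots> = sqrt 2" using real_sqrt_mult[of 4 2] by simp
  finally show ?thesis .
qed

text \<open>The extra factor \<open>w\<close> lets Mills' inequality replace the tail by the
  density, which cancels the prefactor of \<open>stein_sol\<close> exactly.\<close>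

lemma mult_stein_sol_bound:
  assumes "a \<le> b"
  shows "\<bar>w * stein_sol a b w\<bar> \<le> 1"
proof (cases "w = 0")
  case False
  have "\<bar>w * stein_sol a b w\<bar> \<le> \<bar>w\<bar> * (sqrt (2 * pi) * exp (w\<^sup>2 / 2) * (1 - std_Phi \<bar>w\<bar>))"
    unfolding stein_sol_def abs_mult using stein_sol_kernel_bound[OF assms] by (auto intro!: mult_mono)
  also have "\<dots> = sqrt (2 * pi) * exp (w\<^sup>2 / 2) * (\<bar>w\<bar> * (1 - std_Phi \<bar>w\<bar>))" by simp
  also have "\<dots> \<le> sqrt (2 * pi) * exp (w\<^sup>2 / 2) * std_normal_density \<bar>w\<bar>"
    using mills_ratio[of "\<bar>w\<bar>"] False by (intro mult_left_mono) auto
  also have "\<dots> = 1" using sqrt_exp_std_normal_density[of "\<bar>w\<bar>"] by simp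
  finally show ?thesis .
qed simp

lemma stein_sol'_bound:
  assumes "a \<le> b"
  shows "\<bar>stein_sol' a b w\<bar> \<le> 2"
proof -
  have "\<bar>indicator {a..b} w - (std_Phi b - std_Phi a)\<bar> \<le> 1"
    using std_Phi_mono[OF assms] std_Phi_bounds[of a] std_Phi_bounds[of b] by (auto simp: indicator_def)
  then show ?thesis
    using mult_stein_sol_bound[OF assms, of w] unfolding stein_sol'_def by linarith
qed

text \<open>A mean value inequality that tolerates kinks, obtained by integrating \<open>g'\<close>.
  The bound on \<open>g'\<close> is required at every point of the closed interval, which is why
  \<open>stein_sol'\<close> carries values at \<open>a\<close> and \<open>b\<close>.\<close>

lemma abs_diff_le_except_finite:
  fixes g g' :: "real \<Rightarrow> real"
  assumes "finite S" "continuous_on {x..y} g" "x \<le> y"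
    and "\<And>u. u \<in> {x<..<y} - S \<Longrightarrow> (g has_real_derivative g' u) (at u)"
    and "\<And>u. u \<in> {x..y} \<Longrightarrow> \<bar>g' u\<bar> \<le> B"
  shows "\<bar>g y - g x\<bar> \<le> B * (y - x)"
proof -
  have "(g' has_integral (g y - g x)) {x..y}"
    using assms by (intro fundamental_theorem_of_calculus_interior_strong[of S])
      (auto simp: has_real_derivative_iff_has_vector_derivative[symmetric])
  moreover have "0 \<le> B" using assms(5)[of x] assms(3) by fastforce
  ultimately show ?thesis
    using has_integral_bound[of B g' "g y - g x" x y] assms(3,5) by auto
qed

lemma stein_sol_Lipschitz:
  assumes "a \<le> b"
  shows "\<bar>stein_sol a b v - stein_sol a b w\<bar> \<le> 2 * \<bar>v - w\<bar>"
proof -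
  have "\<bar>stein_sol a b y - stein_sol a b x\<bar> \<le> 2 * (y - x)" if "x \<le> y" for x y
    by (rule abs_diff_le_except_finite[of "{a, b}"])
      (use that assms stein_sol'_bound in \<open>auto intro!: DERIV_stein_sol continuous_stein_sol\<close>)
  from this[of v w] this[of w v] show ?thesis by (cases "v \<le> w") (auto simp: abs_minus_commute)
qed

text \<open>The smooth part of the derivative varies at a Lipschitz rate; the indicator part changes
  only if an endpoint \<open>a\<close> or \<open>b\<close> lies between \<open>w\<close> and
  \<open>u\<close>.\<close>

lemma stein_sol'_diff:
  assumes "a \<le> b" "v \<in> {min w u..max w u}"
  shows "\<bar>stein_sol' a b v - stein_sol' a b w\<bar> \<le> (2 * \<bar>w\<bar> + sqrt 2) * \<bar>u - w\<bar>
     + indicator {min w u..max w u} a + indicator {min w u..max w u} b"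
proof -
  let ?f = "stein_sol a b" and ?I = "indicator {a..b} :: real \<Rightarrow> real" and ?J = "{min w u..max w u}"
  have vw: "\<bar>v - w\<bar> \<le> \<bar>u - w\<bar>" using assms(2) by auto
  \<comment> \<open>This splitting attaches the difference of \<open>?f\<close> to \<open>w\<close>,
    whose mean absolute value is later at most 1, and not to the intermediate point
    \<open>v\<close>.\<close>
  have "v * ?f v - w * ?f w = (v - w) * ?f v + w * (?f v - ?f w)" by (simp add: algebra_simps)
  then have "\<bar>v * ?f v - w * ?f w\<bar> \<le> \<bar>v - w\<bar> * \<bar>?f v\<bar> + \<bar>w\<bar> * \<bar>?f v - ?f w\<bar>"
    by (metis abs_mult abs_triangle_ineq)
  also have "\<dots> \<le> \<bar>u - w\<bar> * sqrt 2 + \<bar>w\<bar> * (2 * \<bar>u - w\<bar>)"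
    using vw stein_sol_bound[OF assms(1), of v] stein_sol_Lipschitz[OF assms(1), of v w]
    by (intro add_mono mult_mono) auto
  finally have "\<bar>v * ?f v - w * ?f w\<bar> \<le> (2 * \<bar>w\<bar> + sqrt 2) * \<bar>u - w\<bar>" by (simp add: algebra_simps)
  moreover have "\<bar>?I v - ?I w\<bar> \<le> indicator ?J a + indicator ?J b"
    using assms by (auto simp: indicator_def)
  ultimately show ?thesis unfolding stein_sol'_def by linarith
qed

text \<open>Subtracting the linear function with slope \<open>stein_sol' a b w\<close> leaves a
  function whose derivative is the difference estimated in \<open>stein_sol'_diff\<close>; the mean
  value inequality then gives the remainder.\<close>

lemma stein_sol_taylor:
  assumes "a \<le> b"
  shows "\<bar>stein_sol a b u - stein_sol a b w - (u - w) * stein_sol' a b w\<bar>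
    \<le> \<bar>u - w\<bar> * ((2 * \<bar>w\<bar> + sqrt 2) * \<bar>u - w\<bar>
     + indicator {min w u..max w u} a + indicator {min w u..max w u} b)" (is "_ \<le> _ * ?B")
proof -
  define g where "g v = stein_sol a b v - v * stein_sol' a b w" for v
  have "\<bar>g (max w u) - g (min w u)\<bar> \<le> ?B * (max w u - min w u)"
  proof (rule abs_diff_le_except_finite[of "{a, b}"])
    show "(g has_real_derivative stein_sol' a b v - stein_sol' a b w) (at v)"
      if "v \<in> {min w u<..<max w u} - {a, b}" for v
      unfolding g_def using that DERIV_stein_sol[OF assms]
      by (auto intro!: derivative_eq_intros)
    show "continuous_on {min w u..max w u} g"
      unfolding g_def by (intro continuous_intros continuous_stein_sol)
  qed (use stein_sol'_diff[OF assms] in auto)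
  moreover have "max w u - min w u = \<bar>u - w\<bar>" by auto
  moreover have "\<bar>g (max w u) - g (min w u)\<bar> = \<bar>stein_sol a b u - stein_sol a b w - (u - w) * stein_sol' a b w\<bar>"
    unfolding g_def by (cases "w \<le> u") (auto simp: algebra_simps)
  ultimately show ?thesis by (metis mult.commute)
qed

subsection \<open>Normal approximation from the Stein identity\<close>

text \<open>Bounds the truncated quantity of the concentration argument from below by the second
  moment and the integrand of \<open>\<gamma>\<close>. For \<open>\<bar>x\<bar> \<ge> 1\<close> the
  left side is nonpositive; otherwise a parabola stays below \<open>\<alpha>\<close>, the gap being
  a square that vanishes at \<open>2 * \<alpha>\<close>.\<close>

lemma mult_min_lower_bound:
  fixes x \<alpha> :: real
  assumes "0 < \<alpha>" "4 * \<alpha> \<le> 1"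
  shows "x\<^sup>2 * (1 - min 1 \<bar>x\<bar> / (4 * \<alpha>)) \<le> \<bar>x\<bar> * min \<bar>x\<bar> \<alpha>"
proof (cases "\<bar>x\<bar> \<ge> 1")
  case True
  then have "x\<^sup>2 * (1 - min 1 \<bar>x\<bar> / (4 * \<alpha>)) \<le> 0"
    using assms by (intro mult_nonneg_nonpos) (auto simp: field_simps)
  also have "0 \<le> \<bar>x\<bar> * min \<bar>x\<bar> \<alpha>" using assms by auto
  finally show ?thesis .
next
  case False
  have "\<bar>x\<bar> * (1 - \<bar>x\<bar> / (4 * \<alpha>)) \<le> min \<bar>x\<bar> \<alpha>"
  proof -
    have "\<bar>x\<bar> * (1 - \<bar>x\<bar> / (4 * \<alpha>)) \<le> \<bar>x\<bar>"
      using assms by (intro mult_left_le) auto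
    moreover have "\<alpha> - \<bar>x\<bar> * (1 - \<bar>x\<bar> / (4 * \<alpha>)) = (\<bar>x\<bar> - 2 * \<alpha>)\<^sup>2 / (4 * \<alpha>)"
      using assms by (simp add: field_simps power2_eq_square)
    moreover have "(\<bar>x\<bar> - 2 * \<alpha>)\<^sup>2 / (4 * \<alpha>) \<ge> 0" using assms by simp
    ultimately show ?thesis by linarith
  qed
  then have "\<bar>x\<bar> * (\<bar>x\<bar> * (1 - \<bar>x\<bar> / (4 * \<alpha>))) \<le> \<bar>x\<bar> * min \<bar>x\<bar> \<alpha>"
    by (intro mult_left_mono) auto
  with False show ?thesis by (simp add: power2_eq_square flip: mult.assoc)
qed

text \<open>Here \<open>\<mu>\<close> is the law of one normalised jump, \<open>\<nu>\<close> that
  of the compound Poisson sum with rate \<open>l\<close>. The Poisson structure enters only through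
  \<open>stein_identity\<close>.\<close>

locale compound_poisson_stein =
  \<mu>: real_distribution \<mu> + \<nu>: real_distribution \<nu>
  for \<mu> \<nu> :: "real measure" and l :: real +
  assumes l_pos: "l > 0"
    and integrable_sq: "integrable \<mu> (\<lambda>x. x\<^sup>2)"
    and mean_zero: "(\<integral>x. x \<partial>\<mu>) = 0"
    and variance_one: "l * (\<integral>x. x\<^sup>2 \<partial>\<mu>) = 1"
    and abs_integrable: "integrable \<nu> (\<lambda>w. \<bar>w\<bar>)"
    and abs_le_one: "(\<integral>w. \<bar>w\<bar> \<partial>\<nu>) \<le> 1"
    and stein_identity: "\<And>f B. f \<in> borel_measurable borel \<Longrightarrow> (\<And>w. \<bar>f w\<bar> \<le> B) \<Longrightarrow>
      (\<integral>w. w * f w \<partial>\<nu>) = l * (\<integral>x. x * (\<integral>w. f (w + x) \<partial>\<nu>) \<partial>\<mu>)"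
begin

definition \<gamma> :: real where "\<gamma> = l * (\<integral>x. x\<^sup>2 * min 1 \<bar>x\<bar> \<partial>\<mu>)"

lemma prob_UNIV [simp]: "measure \<nu> UNIV = 1"
  using \<nu>.prob_space by simp

lemma integrable_id: "integrable \<mu> (\<lambda>x. x)"
  by (rule \<mu>.square_integrable_imp_integrable[OF _ integrable_sq]) simp

lemma integrable_gamma: "integrable \<mu> (\<lambda>x. x\<^sup>2 * min 1 \<bar>x\<bar>)"
  by (rule Bochner_Integration.integrable_bound[OF integrable_sq]) (auto simp: abs_mult intro!: mult_left_le)

text \<open>If \<open>\<gamma>\<close> vanished, the jump would be 0 almost surely, against
  \<open>variance_one\<close>. Positivity allows division by \<open>\<alpha> = \<gamma> / 2\<close>
  in the concentration inequality.\<close>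

lemma gamma_pos: "\<gamma> > 0"
proof (rule ccontr)
  assume "\<not> \<gamma> > 0"
  moreover have "(\<integral>x. x\<^sup>2 * min 1 \<bar>x\<bar> \<partial>\<mu>) \<ge> 0" by (intro integral_nonneg_AE) auto
  ultimately have "(\<integral>x. x\<^sup>2 * min 1 \<bar>x\<bar> \<partial>\<mu>) = 0"
    using l_pos unfolding \<gamma>_def by (auto simp: zero_less_mult_iff)
  then have "AE x in \<mu>. x\<^sup>2 * min 1 \<bar>x\<bar> = 0"
    using integral_nonneg_eq_0_iff_AE[OF integrable_gamma] by auto
  then have "AE x in \<mu>. x\<^sup>2 = 0" by eventually_elim (auto simp: min_def split: if_splits)
  then have "(\<integral>x. x\<^sup>2 \<partial>\<mu>) = (\<integral>x. 0 \<partial>\<mu>)" by (intro integral_cong_AE) auto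
  with variance_one show False by simp
qed

lemma integrable_bounded:
  assumes "f \<in> borel_measurable borel" "\<And>w. \<bar>f w\<bar> \<le> (B::real)"
  shows "integrable \<nu> f"
  using assms by (intro \<nu>.integrable_const_bound[of _ B]) auto

text \<open>Since the jump has mean zero, a term constant in \<open>x\<close> can be subtracted
  inside, which turns the Stein identity into one about increments of \<open>f\<close>.\<close>

lemma shift_diff:
  assumes f[measurable]: "f \<in> borel_measurable borel" and B: "\<And>w. \<bar>f w\<bar> \<le> (B::real)"
  shows "integrable \<mu> (\<lambda>x. x * (\<integral>w. f (w + x) - f w \<partial>\<nu>))"
    and "(\<integral>w. w * f w \<partial>\<nu>) = l * (\<integral>x. x * (\<integral>w. f (w + x) - f w \<partial>\<nu>) \<partial>\<mu>)"
proof -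
  have i: "integrable \<nu> (\<lambda>w. f (w + x))" for x
    using B by (intro integrable_bounded[of _ B]) auto
  have "norm (\<integral>w. f (w + x) \<partial>\<nu>) \<le> B" for x
    using integral_mono[OF integrable_norm[OF i[of x]], of "\<lambda>_. B"] B
    by (intro order_trans[OF integral_norm_bound]) (auto simp: \<nu>.prob_space)
  note b = this
  have bf: "norm (x * (\<integral>w. f (w + x) \<partial>\<nu>)) \<le> norm (B * x)" for x
    using mult_left_mono[OF b[of x] abs_ge_zero[of x]] order_trans[OF norm_ge_zero b[of x]]
    by (simp add: abs_mult mult.commute)
  have 1: "integrable \<mu> (\<lambda>x. x * (\<integral>w. f (w + x) \<partial>\<nu>))"
    by (rule Bochner_Integration.integrable_bound[of _ "\<lambda>x. B * x"])
      (use bf in \<open>auto intro!: integrable_mult_right integrable_id\<close>)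
  have 2: "integrable \<mu> (\<lambda>x. x * (\<integral>w. f w \<partial>\<nu>))" by (intro integrable_mult_left integrable_id)
  have eq: "x * (\<integral>w. f (w + x) - f w \<partial>\<nu>) = x * (\<integral>w. f (w + x) \<partial>\<nu>) - x * (\<integral>w. f w \<partial>\<nu>)" for x
    using i[of 0] by (simp add: Bochner_Integration.integral_diff[OF i] algebra_simps)
  show "integrable \<mu> (\<lambda>x. x * (\<integral>w. f (w + x) - f w \<partial>\<nu>))"
    unfolding eq by (intro Bochner_Integration.integrable_diff 1 2)
  have "(\<integral>x. x * (\<integral>w. f (w + x) - f w \<partial>\<nu>) \<partial>\<mu>) = (\<integral>x. x * (\<integral>w. f (w + x) \<partial>\<nu>) \<partial>\<mu>)"
    unfolding eq Bochner_Integration.integral_diff[OF 1 2] using mean_zero by simp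
  then show "(\<integral>w. w * f w \<partial>\<nu>) = l * (\<integral>x. x * (\<integral>w. f (w + x) - f w \<partial>\<nu>) \<partial>\<mu>)"
    using stein_identity[OF f B] by simp
qed

text \<open>The test function \<open>g\<close> has slope 1 on the interval enlarged by
  \<open>\<alpha>\<close> on both sides and is constant beyond. The increment form of the Stein
  identity is at least half the probability sought, while \<open>w * g w\<close> has mean at most
  \<open>B\<close>; and \<open>2 * B = (b - a) + \<gamma>\<close>.\<close>

lemma concentration:
  assumes "a \<le> b" "\<gamma> \<le> 1 / 2"
  shows "measure \<nu> {a..b} \<le> (b - a) + \<gamma>"
proof -
  define \<alpha> where "\<alpha> = \<gamma> / 2" \<comment> \<open>makes \<open>1 - \<gamma> / (4 * \<alpha>)\<close> equal to \<open>1 / 2\<close> below\<close>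
  have \<alpha>: "0 < \<alpha>" "4 * \<alpha> \<le> 1" using gamma_pos assms by (auto simp: \<alpha>_def)
  define B where "B = (b - a) / 2 + \<alpha>"
  have B: "B > 0" using \<alpha> assms by (simp add: B_def add_nonneg_pos)
  define g where "g w = max (- B) (min B (w - (a + b) / 2))" for w :: real
  have g[measurable]: "g \<in> borel_measurable borel" unfolding g_def[abs_def] by measurable
  have gB: "\<bar>g w\<bar> \<le> B" for w using B by (auto simp: g_def)
  let ?p = "measure \<nu> {a..b}"
  have lower: "\<bar>x\<bar> * min \<bar>x\<bar> \<alpha> * indicator {a..b} w \<le> x * (g (w + x) - g w)" for x w
  proof -
    \<comment> \<open>\<open>g\<close> is nondecreasing, so its increment has the sign of the
      shift.\<close>
    have same_sign: "x * (g (w + x) - g w) = \<bar>x\<bar> * \<bar>g (w + x) - g w\<bar>"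
    proof (cases "x \<ge> 0")
      case True
      then have "g w \<le> g (w + x)" unfolding g_def by (intro max.mono min.mono) auto
      with True show ?thesis by simp
    next
      case False
      then have "g (w + x) \<le> g w" unfolding g_def by (intro max.mono min.mono) auto
      with False show ?thesis by (simp add: algebra_simps)
    qed
    \<comment> \<open>From a point of the interval there is room at least \<open>\<alpha>\<close> in
      either direction before \<open>g\<close> becomes flat.\<close>
    have "min \<bar>x\<bar> \<alpha> \<le> \<bar>g (w + x) - g w\<bar>" if "w \<in> {a..b}"
      using that \<alpha> by (auto simp: g_def B_def field_simps min_def max_def abs_if)
    then show ?thesis unfolding same_sign mult.assoc
      by (intro mult_left_mono) (auto simp: indicator_def)
  qed
  have ig: "integrable \<nu> (\<lambda>w. g (w + x) - g w)" for x
    using gB by (intro Bochner_Integration.integrable_diff integrable_bounded[of _ B]) auto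
  have "x\<^sup>2 * (1 - min 1 \<bar>x\<bar> / (4 * \<alpha>)) * ?p \<le> x * (\<integral>w. g (w + x) - g w \<partial>\<nu>)" for x
  proof -
    have "x\<^sup>2 * (1 - min 1 \<bar>x\<bar> / (4 * \<alpha>)) * ?p \<le> \<bar>x\<bar> * min \<bar>x\<bar> \<alpha> * ?p"
      by (intro mult_right_mono mult_min_lower_bound \<alpha>) simp
    also have "\<dots> = (\<integral>w. \<bar>x\<bar> * min \<bar>x\<bar> \<alpha> * indicator {a..b} w \<partial>\<nu>)" by simp
    also have "\<dots> \<le> (\<integral>w. x * (g (w + x) - g w) \<partial>\<nu>)"
      by (intro integral_mono lower integrable_mult_right ig) (auto simp: \<nu>.emeasure_eq_measure)
    finally show ?thesis by simp
  qed
  note pointwise = this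
  have eq: "x\<^sup>2 * (1 - min 1 \<bar>x\<bar> / (4 * \<alpha>)) * ?p = ?p * x\<^sup>2 - ?p / (4 * \<alpha>) * (x\<^sup>2 * min 1 \<bar>x\<bar>)" for x
    by (simp add: algebra_simps)
  have "l * (\<integral>x. x\<^sup>2 * (1 - min 1 \<bar>x\<bar> / (4 * \<alpha>)) * ?p \<partial>\<mu>) = ?p * (l * (\<integral>x. x\<^sup>2 \<partial>\<mu>)) - ?p / (4 * \<alpha>) * \<gamma>"
    unfolding eq \<gamma>_def
      Bochner_Integration.integral_diff[OF integrable_mult_right[OF integrable_sq] integrable_mult_right[OF integrable_gamma]]
    by (simp add: right_diff_distrib)
  also have "\<dots> = ?p / 2" unfolding variance_one using gamma_pos by (simp add: \<alpha>_def)
  finally have "?p / 2 = l * (\<integral>x. x\<^sup>2 * (1 - min 1 \<bar>x\<bar> / (4 * \<alpha>)) * ?p \<partial>\<mu>)" by simp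
  also have "\<dots> \<le> l * (\<integral>x. x * (\<integral>w. g (w + x) - g w \<partial>\<nu>) \<partial>\<mu>)"
  proof (intro mult_left_mono integral_mono pointwise shift_diff(1)[OF g gB])
    show "integrable \<mu> (\<lambda>x. x\<^sup>2 * (1 - min 1 \<bar>x\<bar> / (4 * \<alpha>)) * ?p)"
      unfolding eq by (intro Bochner_Integration.integrable_diff integrable_mult_right integrable_sq integrable_gamma)
  qed (use l_pos in auto)
  also have "\<dots> = (\<integral>w. w * g w \<partial>\<nu>)" by (rule shift_diff(2)[OF g gB, symmetric])
  also have "\<dots> \<le> (\<integral>w. B * \<bar>w\<bar> \<partial>\<nu>)"
  proof -
    have le: "w * g w \<le> B * \<bar>w\<bar>" and nle: "norm (w * g w) \<le> norm (B * \<bar>w\<bar>)" for w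
    proof -
      have "\<bar>w * g w\<bar> \<le> B * \<bar>w\<bar>" using gB[of w] by (simp add: abs_mult mult.commute[of B] mult_left_mono)
      then show "w * g w \<le> B * \<bar>w\<bar>" "norm (w * g w) \<le> norm (B * \<bar>w\<bar>)"
        using B abs_ge_self[of "w * g w"] by auto
    qed
    have "integrable \<nu> (\<lambda>w. w * g w)"
      by (rule Bochner_Integration.integrable_bound[of _ "\<lambda>w. B * \<bar>w\<bar>"])
        (use nle in \<open>auto intro!: integrable_mult_right abs_integrable\<close>)
    then show ?thesis by (intro integral_mono integrable_mult_right abs_integrable le)
  qed
  also have "\<dots> \<le> B" using abs_le_one B by simp
  finally show ?thesis by (simp add: B_def \<alpha>_def field_simps)
qed

theorem normal_approximation:
  assumes ab: "a \<le> b"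
  shows "\<bar>measure \<nu> {a..b} - (std_Phi b - std_Phi a)\<bar> \<le> 7.4184 * \<gamma>"
proof (cases "\<gamma> \<le> 1 / 2")
  case False
  \<comment> \<open>For \<open>\<gamma> > 1 / 2\<close> the claimed bound exceeds 1, so the trivial
    estimate is enough.\<close>
  have "\<bar>measure \<nu> {a..b} - (std_Phi b - std_Phi a)\<bar> \<le> 1"
    using \<nu>.prob_le_1[of "{a..b}"] measure_nonneg[of \<nu> "{a..b}"]
      std_Phi_mono[OF ab] std_Phi_bounds[of a] std_Phi_bounds[of b]
    by arith
  with False show ?thesis by simp
next
  case True
  let ?f = "stein_sol a b" and ?f' = "stein_sol' a b" and ?J = "\<lambda>w x. {min w (w + x)..max w (w + x)}"
  define m where "m = std_Phi b - std_Phi a"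
  note f_bound = stein_sol_bound[OF ab] and f'_bound = stein_sol'_bound[OF ab]
  have f'_int: "integrable \<nu> ?f'" by (rule integrable_bounded[OF _ f'_bound]) simp
  \<comment> \<open>Up to the factor \<open>- x\<close>, this is the mean first order Taylor
    remainder of \<open>?f\<close> for a jump \<open>x\<close>. As \<open>l\<close> times the second
    moment is 1, integrating it gives the mean of \<open>?f' w - w * ?f w\<close>, which Stein's
    equation identifies with the error.\<close>
  define R where "R x = x\<^sup>2 * (\<integral>w. ?f' w \<partial>\<nu>) - x * (\<integral>w. ?f (w + x) - ?f w \<partial>\<nu>)" for x
  have R_int: "integrable \<mu> R"
    unfolding R_def
    by (intro Bochner_Integration.integrable_diff integrable_mult_left integrable_sq
        shift_diff(1)[OF borel_measurable_stein_sol f_bound])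
  have diff_int: "integrable \<nu> (\<lambda>w. ?f (w + x) - ?f w)" for x
    using f_bound by (intro Bochner_Integration.integrable_diff integrable_bounded[of _ "sqrt 2"]) auto
  have remainder: "measure \<nu> {a..b} - m = l * (\<integral>x. R x \<partial>\<mu>)"
  proof -
    have wf: "integrable \<nu> (\<lambda>w. w * ?f w)"
      using mult_stein_sol_bound[OF ab] by (intro integrable_bounded[of _ 1]) auto
    have "(\<integral>w. ?f' w \<partial>\<nu>) = (\<integral>w. w * ?f w \<partial>\<nu>) + measure \<nu> {a..b} - m"
      unfolding stein_sol'_def m_def
      by (subst Bochner_Integration.integral_diff Bochner_Integration.integral_add)+
        (auto simp: wf \<nu>.prob_space \<nu>.emeasure_eq_measure)
    then have "measure \<nu> {a..b} - m = l * (\<integral>x. x\<^sup>2 \<partial>\<mu>) * (\<integral>w. ?f' w \<partial>\<nu>) - (\<integral>w. w * ?f w \<partial>\<nu>)"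
      by (simp add: variance_one)
    also have "\<dots> = l * (\<integral>x. R x \<partial>\<mu>)"
      unfolding R_def shift_diff(2)[OF borel_measurable_stein_sol f_bound]
        Bochner_Integration.integral_diff[OF integrable_mult_left[OF integrable_sq]
          shift_diff(1)[OF borel_measurable_stein_sol f_bound]]
      by (simp add: right_diff_distrib)
    finally show ?thesis .
  qed
  have R_bound: "\<bar>R x\<bar> \<le> (4 + sqrt 2) * (x\<^sup>2 * min 1 \<bar>x\<bar>) + 2 * \<gamma> * x\<^sup>2" for x
  proof -
    have "R x = (\<integral>w. x * (x * ?f' w - (?f (w + x) - ?f w)) \<partial>\<nu>)"
      unfolding R_def using f'_int diff_int[of x]
      by (simp only: integral_mult_right_zero Bochner_Integration.integral_diff[OF integrable_mult_right[OF f'_int] diff_int])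
        (simp add: power2_eq_square right_diff_distrib)
    then have R: "\<bar>R x\<bar> \<le> (\<integral>w. \<bar>x * (x * ?f' w - (?f (w + x) - ?f w))\<bar> \<partial>\<nu>)"
      using integral_norm_bound[of \<nu> "\<lambda>w. x * (x * ?f' w - (?f (w + x) - ?f w))"] by simp
    have i: "integrable \<nu> (\<lambda>w. \<bar>x * (x * ?f' w - (?f (w + x) - ?f w))\<bar>)"
      using f'_int diff_int[of x] by (intro integrable_abs) auto
    show ?thesis
    proof (cases "\<bar>x\<bar> \<le> 1")
      case False
      \<comment> \<open>For large jumps \<open>min 1 \<bar>x\<bar>\<close> is 1, so the bound 2 on
        the derivative and the Lipschitz constant 2 suffice without Taylor expansion.\<close>
      have "\<bar>x * (x * ?f' w - (?f (w + x) - ?f w))\<bar> \<le> 4 * x\<^sup>2" for w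
      proof -
        have "\<bar>x * ?f' w\<bar> \<le> \<bar>x\<bar> * 2"
          unfolding abs_mult using f'_bound by (intro mult_left_mono) auto
        with stein_sol_Lipschitz[OF ab, of "w + x" w]
        have "\<bar>x * ?f' w - (?f (w + x) - ?f w)\<bar> \<le> 4 * \<bar>x\<bar>" by simp
        then have "\<bar>x\<bar> * \<bar>x * ?f' w - (?f (w + x) - ?f w)\<bar> \<le> \<bar>x\<bar> * (4 * \<bar>x\<bar>)"
          by (intro mult_left_mono) auto
        then show ?thesis by (simp add: abs_mult power2_eq_square)
      qed
      then have "(\<integral>w. \<bar>x * (x * ?f' w - (?f (w + x) - ?f w))\<bar> \<partial>\<nu>) \<le> (\<integral>w. 4 * x\<^sup>2 \<partial>\<nu>)"
        by (intro integral_mono i) auto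
      with R have "\<bar>R x\<bar> \<le> 4 * x\<^sup>2" by (simp add: \<nu>.prob_space)
      also have "\<dots> \<le> (4 + sqrt 2) * x\<^sup>2 + 2 * \<gamma> * x\<^sup>2"
        using gamma_pos by (simp add: algebra_simps)
      finally show ?thesis using False by simp
    next
      case True
      have J: "measure \<nu> {w. c \<in> ?J w x} \<le> \<bar>x\<bar> + \<gamma>" "(\<lambda>w. indicator (?J w x) c) = indicator {w. c \<in> ?J w x}"
        "{w. c \<in> ?J w x} \<in> sets borel" for c :: real
      proof -
        \<comment> \<open>The kink \<open>c\<close> lies between \<open>w\<close> and
          \<open>w + x\<close> exactly when \<open>w\<close> is in an interval of length
          \<open>\<bar>x\<bar>\<close>, to which the concentration inequality applies.\<close>
        have "{w. c \<in> ?J w x} = {c - max 0 x..c - min 0 x}" by auto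
        moreover have "measure \<nu> {c - max 0 x..c - min 0 x} \<le> (c - min 0 x) - (c - max 0 x) + \<gamma>"
          by (rule concentration) (use \<open>\<gamma> \<le> 1 / 2\<close> in auto)
        ultimately show "measure \<nu> {w. c \<in> ?J w x} \<le> \<bar>x\<bar> + \<gamma>" "{w. c \<in> ?J w x} \<in> sets borel" by auto
      qed (auto simp: indicator_def)
      have Jint: "integrable \<nu> (\<lambda>w. indicator (?J w x) c :: real)"
        "(\<integral>w. indicator (?J w x) c \<partial>\<nu>) \<le> \<bar>x\<bar> + \<gamma>" for c :: real
        using J(1)[of c] J(3)[of c] unfolding J(2) by (auto simp: \<nu>.emeasure_eq_measure)
      let ?H = "\<lambda>w. \<bar>x\<bar> * (\<bar>x\<bar> * ((2 * \<bar>w\<bar> + sqrt 2) * \<bar>x\<bar> + indicator (?J w x) a + indicator (?J w x) b))"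
      have "\<bar>x * (x * ?f' w - (?f (w + x) - ?f w))\<bar> \<le> ?H w" for w
      proof -
        have "\<bar>x * ?f' w - (?f (w + x) - ?f w)\<bar>
            \<le> \<bar>x\<bar> * ((2 * \<bar>w\<bar> + sqrt 2) * \<bar>x\<bar> + indicator (?J w x) a + indicator (?J w x) b)"
          using stein_sol_taylor[OF ab, of "w + x" w] by (simp add: abs_minus_commute)
        then show ?thesis unfolding abs_mult by (intro mult_left_mono) auto
      qed
      then have "\<bar>R x\<bar> \<le> (\<integral>w. ?H w \<partial>\<nu>)"
        by (intro order_trans[OF R] integral_mono i integrable_mult_right integrable_mult_left
            Bochner_Integration.integrable_add Jint(1) abs_integrable) auto
      also have "\<dots> = \<bar>x\<bar> * (\<bar>x\<bar> * ((2 * (\<integral>w. \<bar>w\<bar> \<partial>\<nu>) + sqrt 2) * \<bar>x\<bar>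
          + (\<integral>w. indicator (?J w x) a \<partial>\<nu>) + (\<integral>w. indicator (?J w x) b \<partial>\<nu>)))"
        using Jint(1) abs_integrable by (simp add: \<nu>.prob_space)
      \<comment> \<open>The mean of \<open>\<bar>w\<bar>\<close> contributes 2, and each of the two
        kinks contributes \<open>\<bar>x\<bar> + \<gamma>\<close>: hence the coefficients
        \<open>4 + sqrt 2\<close> and 2.\<close>
      also have "\<dots> \<le> \<bar>x\<bar> * (\<bar>x\<bar> * ((2 * 1 + sqrt 2) * \<bar>x\<bar> + (\<bar>x\<bar> + \<gamma>) + (\<bar>x\<bar> + \<gamma>)))"
        using Jint(2) abs_le_one by (intro mult_left_mono add_mono mult_right_mono) auto
      also have "\<dots> = (4 + sqrt 2) * ((\<bar>x\<bar> * \<bar>x\<bar>) * \<bar>x\<bar>) + 2 * \<gamma> * (\<bar>x\<bar> * \<bar>x\<bar>)"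
        by algebra
      finally show ?thesis using True by (simp add: power2_eq_square)
    qed
  qed
  have "\<bar>l * (\<integral>x. R x \<partial>\<mu>)\<bar> \<le> l * (\<integral>x. \<bar>R x\<bar> \<partial>\<mu>)"
    using l_pos by (simp add: abs_mult)
  also have "\<dots> \<le> l * (\<integral>x. (4 + sqrt 2) * (x\<^sup>2 * min 1 \<bar>x\<bar>) + 2 * \<gamma> * x\<^sup>2 \<partial>\<mu>)"
    using l_pos by (intro mult_left_mono integral_mono R_bound integrable_abs R_int)
      (auto intro!: integrable_sq integrable_gamma)
  also have "\<dots> = (4 + sqrt 2) * \<gamma> + 2 * \<gamma> * (l * (\<integral>x. x\<^sup>2 \<partial>\<mu>))"
    unfolding \<gamma>_def using integrable_sq integrable_gamma by (simp add: algebra_simps)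
  also have "\<dots> = (6 + sqrt 2) * \<gamma>" unfolding variance_one by (simp add: algebra_simps)
  also have "\<dots> \<le> 7.4184 * \<gamma>"
  proof -
    have "sqrt 2 \<le> 1.4184" by (rule real_le_lsqrt) (auto simp: power2_eq_square)
    then show ?thesis using gamma_pos by (intro mult_right_mono) auto
  qed
  finally show ?thesis unfolding m_def[symmetric] remainder .
qed

end

subsection \<open>Compound Poisson sums\<close>

lemma integral_poisson_sums:
  fixes h :: "nat \<Rightarrow> real"
  assumes l: "l > 0" and s: "summable (\<lambda>k. l ^ k / fact k * exp (- l) * \<bar>h k\<bar>)"
  shows "integrable (poisson_pmf l) h"
    and "(\<lambda>k. l ^ k / fact k * exp (- l) * h k) sums (LINT k|poisson_pmf l. h k)"
proof -
  have i: "integrable (count_space UNIV) (\<lambda>k. l ^ k / fact k * exp (- l) * h k)"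
    using l s by (simp add: integrable_count_space_nat_iff abs_mult)
  then show "integrable (poisson_pmf l) h"
    using l unfolding measure_pmf_eq_density
    by (subst integrable_density) (auto simp: mult_ac)
  have "(LINT k|poisson_pmf l. h k) = (LINT k|count_space UNIV. l ^ k / fact k * exp (- l) * h k)"
    using l unfolding measure_pmf_eq_density
    by (subst integral_density) (auto simp: mult_ac)
  then show "(\<lambda>k. l ^ k / fact k * exp (- l) * h k) sums (LINT k|poisson_pmf l. h k)"
    using sums_integral_count_space_nat[OF i] by simp
qed

lemma summable_poisson_bounded:
  fixes g :: "nat \<Rightarrow> real"
  assumes l: "l > 0" and B: "\<And>k. \<bar>g k\<bar> \<le> B"
  shows "summable (\<lambda>k. l ^ k / fact k * exp (- l) * \<bar>g k\<bar>)"
proof (rule summable_comparison_test'[of "\<lambda>k. B * exp (- l) * (l ^ k / fact k)"])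
  show "summable (\<lambda>k. B * exp (- l) * (l ^ k / fact k))"
    using summable_exp[of l] by (intro summable_mult) (simp add: field_simps)
  show "norm (l ^ k / fact k * exp (- l) * \<bar>g k\<bar>) \<le> B * exp (- l) * (l ^ k / fact k)" for k
    using l mult_left_mono[OF B[of k], of "l ^ k / fact k * exp (- l)"] by (simp add: abs_mult mult_ac)
qed

text \<open>The Poisson weights satisfy \<open>(k + 1) * p (k + 1) = l * p k\<close>, so the
  identity is an index shift in the series.\<close>

lemma poisson_size_bias:
  fixes g :: "nat \<Rightarrow> real"
  assumes l: "l > 0" and B: "\<And>k. \<bar>g k\<bar> \<le> B"
  shows "integrable (poisson_pmf l) (\<lambda>k. real k * g (k - 1))"
    and "(LINT k|poisson_pmf l. real k * g (k - 1)) = l * (LINT k|poisson_pmf l. g k)"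
proof -
  let ?p = "\<lambda>k. l ^ k / fact k * exp (- l)"
  have shift: "?p (Suc k) * (real (Suc k) * x) = l * (?p k * x)" for k x
    by (simp add: divide_simps)
  have "summable (\<lambda>k. l * (?p k * \<bar>g k\<bar>))"
    by (intro summable_mult summable_poisson_bounded[OF l B])
  then have s: "summable (\<lambda>k. ?p k * \<bar>real k * g (k - 1)\<bar>)"
    by (subst summable_Suc_iff[symmetric]) (simp only: abs_mult abs_of_nat shift diff_Suc_1)
  show "integrable (poisson_pmf l) (\<lambda>k. real k * g (k - 1))"
    by (rule integral_poisson_sums(1)[OF l s])
  \<comment> \<open>The dropped term at 0 contains the default \<open>0 - 1 = 0\<close> but vanishes
    through its factor \<open>real 0\<close>.\<close>
  have "(\<lambda>k. ?p (Suc k) * (real (Suc k) * g (Suc k - 1))) sums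
      ((LINT k|poisson_pmf l. real k * g (k - 1)) - ?p 0 * (real 0 * g (0 - 1)))"
    by (subst sums_Suc_iff) (use integral_poisson_sums(2)[OF l s] in simp)
  moreover have "(\<lambda>k. l * (?p k * g k)) sums (l * (LINT k|poisson_pmf l. g k))"
    by (intro sums_mult integral_poisson_sums(2) l summable_poisson_bounded[OF l B])
  ultimately show "(LINT k|poisson_pmf l. real k * g (k - 1)) = l * (LINT k|poisson_pmf l. g k)"
    unfolding shift diff_Suc_1 by (auto dest: sums_unique2)
qed

section \<open>Partial sums of centred independent identically distributed variables\<close>

locale iid_centered = prob_space M for M :: "'a measure" +
  fixes X :: "nat \<Rightarrow> 'a \<Rightarrow> real"
  assumes indep: "indep_vars (\<lambda>_. borel) X {1..}"
    and ident: "\<And>i. i \<ge> 1 \<Longrightarrow> distr M borel (X i) = distr M borel (X 1)"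
    and integrable_X1_sq: "integrable M (\<lambda>\<omega>. (X 1 \<omega>)\<^sup>2)"
    and mean_X1: "expectation (X 1) = 0"
begin

definition S :: "nat \<Rightarrow> 'a \<Rightarrow> real" where "S k \<omega> = (\<Sum>i=1..k. X i \<omega>)"

abbreviation "\<mu> \<equiv> distr M borel (X 1)"

lemma random_variable_X [measurable]: "i \<ge> 1 \<Longrightarrow> random_variable borel (X i)"
  using indep unfolding indep_vars_def by auto

lemma random_variable_X1 [measurable]: "random_variable borel (X 1)" "random_variable borel (X (Suc 0))"
  using random_variable_X[of 1] by simp_all

lemma random_variable_sum: "J \<subseteq> {1..} \<Longrightarrow> random_variable borel (\<lambda>\<omega>. \<Sum>i\<in>J. X i \<omega>)"
  by (intro borel_measurable_sum random_variable_X) auto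

lemma random_variable_S [measurable]: "random_variable borel (S k)"
  unfolding S_def[abs_def] by (intro random_variable_sum) auto

lemma prob_space_mu: "prob_space \<mu>"
  by (rule prob_space_distr) measurable

lemma integrable_mu_id: "integrable \<mu> (\<lambda>x. x)"
  by (rule finite_measure.square_integrable_imp_integrable[OF prob_space.finite_measure[OF prob_space_mu]])
    (simp_all add: integrable_distr_eq integrable_X1_sq[simplified])

lemma integrable_X_iff:
  assumes "i \<ge> 1" "g \<in> borel_measurable borel"
  shows "integrable M (\<lambda>\<omega>. g (X i \<omega>) :: real) \<longleftrightarrow> integrable M (\<lambda>\<omega>. g (X 1 \<omega>))"
  using integrable_distr_eq[OF random_variable_X[OF assms(1)] assms(2)]
    integrable_distr_eq[OF random_variable_X1(1) assms(2)]
  unfolding ident[OF assms(1)] by argo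

lemma expectation_X_eq:
  assumes "i \<ge> 1" "g \<in> borel_measurable borel"
  shows "expectation (\<lambda>\<omega>. g (X i \<omega>) :: real) = expectation (\<lambda>\<omega>. g (X 1 \<omega>))"
  using integral_distr[OF random_variable_X[OF assms(1)] assms(2)]
    integral_distr[OF random_variable_X1(1) assms(2)]
  unfolding ident[OF assms(1)] by argo

lemma integrable_X_sq: "i \<ge> 1 \<Longrightarrow> integrable M (\<lambda>\<omega>. (X i \<omega>)\<^sup>2)"
  using integrable_X_iff[of i "\<lambda>x. x\<^sup>2"] integrable_X1_sq by simp

lemma expectation_X_sq: "i \<ge> 1 \<Longrightarrow> expectation (\<lambda>\<omega>. (X i \<omega>)\<^sup>2) = expectation (\<lambda>\<omega>. (X 1 \<omega>)\<^sup>2)"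
  by (rule expectation_X_eq[of i "\<lambda>x. x\<^sup>2"]) auto

lemma expectation_X: "i \<ge> 1 \<Longrightarrow> expectation (X i) = 0"
  using expectation_X_eq[of i "\<lambda>x. x"] mean_X1 by simp

lemma integrable_X: "i \<ge> 1 \<Longrightarrow> integrable M (X i)"
  by (rule square_integrable_imp_integrable[OF random_variable_X integrable_X_sq])

lemma indep_var_X_sum:
  assumes "finite J" "i \<notin> J" "insert i J \<subseteq> {1..}"
  shows "indep_var borel (X i) borel (\<lambda>\<omega>. \<Sum>j\<in>J. X j \<omega>)"
  using assms by (intro indep_vars_sum indep_vars_subset[OF indep])

lemma S_Suc: "S (Suc k) = (\<lambda>\<omega>. X (Suc k) \<omega> + S k \<omega>)"
  by (auto simp: S_def fun_eq_iff)

lemma indep_var_X_S: "indep_var borel (X (Suc k)) borel (S k)"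
  unfolding S_def[abs_def] by (intro indep_var_X_sum) auto

text \<open>Removing one summand from \<open>S k\<close> leaves a sum over a set that is no initial
  segment; by convolution its law depends only on the number of summands.\<close>

lemma distr_sum:
  assumes "finite J" "J \<subseteq> {1..}"
  shows "distr M borel (\<lambda>\<omega>. \<Sum>j\<in>J. X j \<omega>) = distr M borel (S (card J))"
  using assms
proof (induction J)
  case empty
  then show ?case by (simp add: S_def[abs_def])
next
  case (insert i J)
  have "distr M borel (\<lambda>\<omega>. \<Sum>j\<in>insert i J. X j \<omega>) = distr M borel (\<lambda>\<omega>. X i \<omega> + (\<Sum>j\<in>J. X j \<omega>))"
    using insert by simp
  also have "\<dots> = convolution (distr M borel (X i)) (distr M borel (\<lambda>\<omega>. \<Sum>j\<in>J. X j \<omega>))"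
    using insert by (intro sum_indep_random_variable indep_var_X_sum random_variable_X random_variable_sum) auto
  also have "\<dots> = convolution (distr M borel (X (Suc (card J)))) (distr M borel (S (card J)))"
    using insert ident[of i] ident[of "Suc (card J)"] by simp
  also have "\<dots> = distr M borel (\<lambda>\<omega>. X (Suc (card J)) \<omega> + S (card J) \<omega>)"
    by (intro sum_indep_random_variable[symmetric] indep_var_X_S random_variable_X random_variable_S) auto
  finally show ?case using insert by (simp add: S_Suc)
qed

text \<open>The claims are proved jointly because the induction step needs all of them: the cross
  term is integrable and has mean zero by independence and centring.\<close>

lemma S_square:
  "integrable M (\<lambda>\<omega>. (S k \<omega>)\<^sup>2) \<and> expectation (S k) = 0 \<and>
   expectation (\<lambda>\<omega>. (S k \<omega>)\<^sup>2) = real k * expectation (\<lambda>\<omega>. (X 1 \<omega>)\<^sup>2)"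
proof (induction k)
  case (Suc k)
  note ih = Suc[THEN conjunct1] Suc[THEN conjunct2, THEN conjunct1] Suc[THEN conjunct2, THEN conjunct2]
  let ?i = "Suc k"
  have iS: "integrable M (S k)" by (rule square_integrable_imp_integrable[OF _ ih(1)]) simp
  have iX: "integrable M (X ?i)" "integrable M (\<lambda>\<omega>. (X ?i \<omega>)\<^sup>2)" by (auto intro: integrable_X integrable_X_sq)
  have prod: "integrable M (\<lambda>\<omega>. X ?i \<omega> * S k \<omega>)" "expectation (\<lambda>\<omega>. X ?i \<omega> * S k \<omega>) = 0"
    using indep_var_integrable[OF indep_var_X_S iX(1) iS] indep_var_lebesgue_integral[OF indep_var_X_S iX(1) iS] ih(2)
    by auto
  have eq: "(S ?i \<omega>)\<^sup>2 = ((X ?i \<omega>)\<^sup>2 + 2 * (X ?i \<omega> * S k \<omega>)) + (S k \<omega>)\<^sup>2" for \<omega>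
    unfolding S_Suc by (simp add: power2_eq_square algebra_simps)
  have "expectation (\<lambda>\<omega>. (S ?i \<omega>)\<^sup>2) = expectation (\<lambda>\<omega>. (X 1 \<omega>)\<^sup>2) + real k * expectation (\<lambda>\<omega>. (X 1 \<omega>)\<^sup>2)"
    unfolding eq using prod iX ih(1) by (simp add: ih(3) expectation_X_sq[of ?i, simplified])
  moreover have "expectation (S ?i) = 0"
    unfolding S_Suc using iS iX by (simp add: ih(2) expectation_X)
  moreover have "integrable M (\<lambda>\<omega>. (S ?i \<omega>)\<^sup>2)"
    unfolding eq using prod iX ih(1) by simp
  ultimately show ?case by (simp add: algebra_simps)
qed (simp add: S_def)

lemma integrable_S_shift:
  assumes "f \<in> borel_measurable borel" "\<And>w. \<bar>f w\<bar> \<le> (B::real)"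
  shows "integrable M (\<lambda>\<omega>. f (S k \<omega> + x))"
    and "\<bar>expectation (\<lambda>\<omega>. f (S k \<omega> + x))\<bar> \<le> B"
proof -
  show i: "integrable M (\<lambda>\<omega>. f (S k \<omega> + x))"
    using assms by (intro integrable_const_bound[of _ B]) auto
  have "\<bar>expectation (\<lambda>\<omega>. f (S k \<omega> + x))\<bar> \<le> expectation (\<lambda>\<omega>. \<bar>f (S k \<omega> + x)\<bar>)"
    using integral_norm_bound[of M "\<lambda>\<omega>. f (S k \<omega> + x)"] by simp
  also have "\<dots> \<le> expectation (\<lambda>\<omega>. B)" using i assms(2) by (intro integral_mono) auto
  finally show "\<bar>expectation (\<lambda>\<omega>. f (S k \<omega> + x))\<bar> \<le> B" by (simp add: prob_space)
qed

text \<open>Write \<open>S k\<close> as \<open>X i\<close> plus the remaining sum \<open>T\<close>.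
  The two are independent and \<open>T\<close> is distributed as \<open>S (k - 1)\<close>, so the
  mean factors through the product law and Fubini's theorem.\<close>

lemma expectation_term:
  assumes f[measurable]: "f \<in> borel_measurable borel" and B: "\<And>w. \<bar>f w\<bar> \<le> (B::real)" and i: "i \<in> {1..k}"
  shows "integrable M (\<lambda>\<omega>. X i \<omega> * f (S k \<omega>))"
    and "expectation (\<lambda>\<omega>. X i \<omega> * f (S k \<omega>)) = (\<integral>x. x * expectation (\<lambda>\<omega>. f (S (k - 1) \<omega> + x)) \<partial>\<mu>)"
proof -
  define T where "T \<omega> = (\<Sum>j\<in>{1..k} - {i}. X j \<omega>)" for \<omega>
  have iX: "integrable M (X i)" using i by (intro integrable_X) auto
  have ST: "S k \<omega> = T \<omega> + X i \<omega>" for \<omega>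
    using sum.remove[of "{1..k}" i "\<lambda>j. X j \<omega>"] i unfolding S_def T_def by simp
  have ind: "indep_var borel (X i) borel T"
    unfolding T_def[abs_def] using i by (intro indep_var_X_sum) auto
  note [measurable] = indep_var_rv1[OF ind] indep_var_rv2[OF ind]
  have T: "distr M borel T = distr M borel (S (k - 1))"
    unfolding T_def[abs_def] using i by (subst distr_sum) auto
  have law: "distr M (borel \<Otimes>\<^sub>M borel) (\<lambda>\<omega>. (X i \<omega>, T \<omega>)) = \<mu> \<Otimes>\<^sub>M distr M borel (S (k - 1))"
    using ind T ident[of i] i unfolding indep_var_distribution_eq by simp
  interpret \<mu>: prob_space \<mu> by (rule prob_space_mu)
  interpret T: prob_space "distr M borel (S (k - 1))" by (rule prob_space_distr) measurable
  interpret P: pair_prob_space \<mu> "distr M borel (S (k - 1))" ..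
  let ?h = "\<lambda>p. fst p * f (snd p + fst p) :: real"
  have h[measurable]: "?h \<in> borel_measurable (borel \<Otimes>\<^sub>M borel)" by measurable
  have bd: "norm (X i \<omega> * f (S k \<omega>)) \<le> norm (B * X i \<omega>)" for \<omega>
    using mult_left_mono[OF B[of "S k \<omega>"] abs_ge_zero[of "X i \<omega>"]] order_trans[OF abs_ge_zero B]
    by (simp add: abs_mult mult.commute)
  show int: "integrable M (\<lambda>\<omega>. X i \<omega> * f (S k \<omega>))"
    by (rule Bochner_Integration.integrable_bound[of _ "\<lambda>\<omega>. B * X i \<omega>"])
      (use bd iX in auto)
  then have "integrable (distr M (borel \<Otimes>\<^sub>M borel) (\<lambda>\<omega>. (X i \<omega>, T \<omega>))) ?h"
    by (subst integrable_distr_eq) (auto simp: ST)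
  then have int2: "integrable (\<mu> \<Otimes>\<^sub>M distr M borel (S (k - 1))) ?h" by (simp only: law)
  have "expectation (\<lambda>\<omega>. X i \<omega> * f (S k \<omega>)) = (\<integral>p. ?h p \<partial>distr M (borel \<Otimes>\<^sub>M borel) (\<lambda>\<omega>. (X i \<omega>, T \<omega>)))"
    by (subst integral_distr) (auto simp: ST)
  also have "\<dots> = (\<integral>p. ?h p \<partial>(\<mu> \<Otimes>\<^sub>M distr M borel (S (k - 1))))" by (simp only: law)
  also have "\<dots> = (\<integral>x. (\<integral>t. ?h (x, t) \<partial>distr M borel (S (k - 1))) \<partial>\<mu>)"
    by (rule P.integral_fst'[OF int2, symmetric])
  also have "\<dots> = (\<integral>x. x * expectation (\<lambda>\<omega>. f (S (k - 1) \<omega> + x)) \<partial>\<mu>)"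
    by (simp add: integral_distr)
  finally show "expectation (\<lambda>\<omega>. X i \<omega> * f (S k \<omega>)) = \<dots>" .
qed

text \<open>Every summand contributes the same amount. For \<open>k = 0\<close> the truncated
  difference \<open>k - 1\<close> is multiplied by 0.\<close>

lemma expectation_S_mult:
  assumes "f \<in> borel_measurable borel" "\<And>w. \<bar>f w\<bar> \<le> (B::real)"
  shows "expectation (\<lambda>\<omega>. S k \<omega> * f (S k \<omega>)) =
    real k * (\<integral>x. x * expectation (\<lambda>\<omega>. f (S (k - 1) \<omega> + x)) \<partial>\<mu>)"
proof -
  have "expectation (\<lambda>\<omega>. S k \<omega> * f (S k \<omega>)) = expectation (\<lambda>\<omega>. \<Sum>i=1..k. X i \<omega> * f (S k \<omega>))"
    by (simp add: S_def sum_distrib_right)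
  also have "\<dots> = (\<Sum>i=1..k. expectation (\<lambda>\<omega>. X i \<omega> * f (S k \<omega>)))"
    by (rule Bochner_Integration.integral_sum) (rule expectation_term(1)[OF assms])
  also have "\<dots> = (\<Sum>i=1..k. (\<integral>x. x * expectation (\<lambda>\<omega>. f (S (k - 1) \<omega> + x)) \<partial>\<mu>))"
    by (intro sum.cong refl expectation_term(2)[OF assms])
  finally show ?thesis by simp
qed


section \<open>The compound Poisson sum with a fixed rate\<close>

context
  fixes l :: real
  assumes l_pos: "l > 0"
begin

abbreviation "pois \<equiv> measure_pmf (poisson_pmf l)"

text \<open>The first coordinate is the number of summands; the product measure makes it Poisson
  distributed and independent of \<open>X\<close>.\<close>

abbreviation W :: "nat \<times> 'a \<Rightarrow> real" where "W p \<equiv> S (fst p) (snd p)"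

lemma measurable_pois_pair:
  assumes "\<And>k. (\<lambda>y. g (k, y)) \<in> borel_measurable N"
  shows "g \<in> borel_measurable (pois \<Otimes>\<^sub>M N)"
proof -
  have "sets (pois \<Otimes>\<^sub>M N) = sets (count_space UNIV \<Otimes>\<^sub>M N)"
    by (intro sets_pair_measure_cong) auto
  with measurable_pair_measure_countable1[of UNIV g N borel] assms show ?thesis
    by (simp cong: measurable_cong_sets)
qed

lemma borel_measurable_W [measurable]: "W \<in> borel_measurable (pois \<Otimes>\<^sub>M M)"
  by (rule measurable_pois_pair) simp

lemma pair_prob_space_pois: "pair_prob_space pois M"
  by (intro pair_prob_space.intro pair_sigma_finite.intro prob_space_imp_sigma_finite
      prob_space_measure_pmf prob_space_axioms)

lemma pois_pair_integrable_sq: "integrable (pois \<Otimes>\<^sub>M M) (\<lambda>p. (W p)\<^sup>2)"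
  and pois_pair_expectation_sq: "(\<integral>p. (W p)\<^sup>2 \<partial>(pois \<Otimes>\<^sub>M M)) = l * expectation (\<lambda>\<omega>. (X 1 \<omega>)\<^sup>2)"
proof -
  interpret P: pair_prob_space pois M by (rule pair_prob_space_pois)
  let ?v = "expectation (\<lambda>\<omega>. (X 1 \<omega>)\<^sup>2)"
  \<comment> \<open>Size bias for a constant function gives the Poisson mean
    \<open>l\<close>.\<close>
  have b: "integrable pois (\<lambda>k. real k * ?v)" "(LINT k|pois. real k * ?v) = l * ?v"
    using poisson_size_bias[OF l_pos, of "\<lambda>_. ?v" "\<bar>?v\<bar>"] by auto
  show i: "integrable (pois \<Otimes>\<^sub>M M) (\<lambda>p. (W p)\<^sup>2)"
    using b S_square by (intro P.Fubini_integrable) simp_all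
  show "(\<integral>p. (W p)\<^sup>2 \<partial>(pois \<Otimes>\<^sub>M M)) = l * ?v"
    using P.integral_fst'[OF i] b S_square by simp
qed

lemma pois_pair_expectation_bounded:
  assumes f[measurable]: "f \<in> borel_measurable borel" and B: "\<And>w. \<bar>f w\<bar> \<le> (B::real)"
  shows "(\<integral>p. f (W p + x) \<partial>(pois \<Otimes>\<^sub>M M)) = (LINT k|pois. expectation (\<lambda>\<omega>. f (S k \<omega> + x)))"
proof -
  interpret P: pair_prob_space pois M by (rule pair_prob_space_pois)
  have "integrable (pois \<Otimes>\<^sub>M M) (\<lambda>p. f (W p + x))"
    using B by (intro P.P.integrable_const_bound[of _ B]) auto
  from P.integral_fst'[OF this] show ?thesis by simp
qed

text \<open>Given \<open>k\<close> summands, \<open>expectation_S_mult\<close> yields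
  \<open>k\<close> times a function of \<open>k - 1\<close>; the Poisson size bias replaces this by
  \<open>l\<close> times that function of \<open>k\<close>, and Fubini's theorem restores the order
  of integration.\<close>

lemma pois_pair_stein_identity:
  assumes f[measurable]: "f \<in> borel_measurable borel" and B: "\<And>w. \<bar>f w\<bar> \<le> (B::real)"
  shows "(\<integral>p. W p * f (W p) \<partial>(pois \<Otimes>\<^sub>M M)) = l * (\<integral>x. x * (\<integral>p. f (W p + x) \<partial>(pois \<Otimes>\<^sub>M M)) \<partial>\<mu>)"
proof -
  interpret P: pair_prob_space pois M by (rule pair_prob_space_pois)
  interpret \<mu>: prob_space \<mu> by (rule prob_space_mu)
  interpret Q: pair_prob_space pois \<mu> ..
  define H where "H k x = x * expectation (\<lambda>\<omega>. f (S k \<omega> + x))" for k x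
  have H[measurable]: "H k \<in> borel_measurable borel" for k unfolding H_def[abs_def] by measurable
  have H_bound: "\<bar>H k x\<bar> \<le> B * \<bar>x\<bar>" for k x
    using mult_left_mono[OF integrable_S_shift(2)[OF f B] abs_ge_zero[of x]]
    by (simp add: H_def abs_mult mult.commute)
  have B0: "0 \<le> B" using B[of 0] by simp
  have intB: "integrable \<mu> (\<lambda>x. B * \<bar>x\<bar>)"
    by (intro integrable_mult_right Bochner_Integration.integrable_abs integrable_mu_id)
  have H_int: "integrable \<mu> (H k)" for k
    by (rule Bochner_Integration.integrable_bound[OF intB]) (use H_bound B0 in \<open>auto simp: abs_mult\<close>)
  \<comment> \<open>A bound independent of \<open>k\<close>, as \<open>poisson_size_bias\<close>
    demands.\<close>
  define c where "c = (\<integral>x. B * \<bar>x\<bar> \<partial>\<mu>)"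
  have "(\<integral>x. \<bar>H k x\<bar> \<partial>\<mu>) \<le> c" for k
    unfolding c_def using H_int intB H_bound by (intro integral_mono) auto
  then have G_bound: "\<bar>\<integral>x. H k x \<partial>\<mu>\<bar> \<le> c" "\<bar>\<integral>x. \<bar>H k x\<bar> \<partial>\<mu>\<bar> \<le> c" for k
    using order_trans[OF integral_norm_bound[of \<mu> "H k"]] by simp_all
  have int2: "integrable (pois \<Otimes>\<^sub>M \<mu>) (\<lambda>(k, x). H k x)"
  proof (rule Q.Fubini_integrable)
    show "integrable pois (\<lambda>k. \<integral>x. norm (case (k, x) of (k, x) \<Rightarrow> H k x) \<partial>\<mu>)"
      using G_bound(2) by (intro measure_pmf.integrable_const_bound[of _ c]) auto
  qed (auto intro!: measurable_pois_pair AE_pmfI H_int[simplified])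
  have int1: "integrable (pois \<Otimes>\<^sub>M M) (\<lambda>p. W p * f (W p))"
  proof (rule Bochner_Integration.integrable_bound[of _ "\<lambda>p. B * (1 + (W p)\<^sup>2)"])
    show "integrable (pois \<Otimes>\<^sub>M M) (\<lambda>p. B * (1 + (W p)\<^sup>2))"
      using pois_pair_integrable_sq by auto
    have "\<bar>w * f w\<bar> \<le> B * (1 + w\<^sup>2)" for w
    proof -
      \<comment> \<open>Reduces integrability of \<open>W p * f (W p)\<close> to the second moment
        of \<open>W\<close>.\<close>
      have "\<bar>w\<bar> \<le> 1 + w\<^sup>2"
        using zero_le_power2[of "\<bar>w\<bar> - 1 / 2"] by (simp add: power2_eq_square algebra_simps)
      then have "\<bar>f w\<bar> * \<bar>w\<bar> \<le> B * (1 + w\<^sup>2)" using B[of w] B0 by (intro mult_mono) auto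
      then show ?thesis by (simp add: abs_mult mult.commute)
    qed
    then show "AE p in pois \<Otimes>\<^sub>M M. norm (W p * f (W p)) \<le> norm (B * (1 + (W p)\<^sup>2))"
      using B0 by (auto simp: abs_mult)
  qed measurable
  have "(\<integral>p. W p * f (W p) \<partial>(pois \<Otimes>\<^sub>M M)) = (LINT k|pois. expectation (\<lambda>\<omega>. S k \<omega> * f (S k \<omega>)))"
    using P.integral_fst'[OF int1] by simp
  also have "\<dots> = (LINT k|pois. real k * (\<integral>x. H (k - 1) x \<partial>\<mu>))"
    unfolding expectation_S_mult[OF f B] H_def ..
  also have "\<dots> = l * (LINT k|pois. \<integral>x. H k x \<partial>\<mu>)"
    by (rule poisson_size_bias(2)[OF l_pos G_bound(1)])
  also have "\<dots> = l * (\<integral>x. (LINT k|pois. H k x) \<partial>\<mu>)"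
    using Q.Fubini_integral[of H] int2 by simp
  also have "\<dots> = l * (\<integral>x. x * (\<integral>p. f (W p + x) \<partial>(pois \<Otimes>\<^sub>M M)) \<partial>\<mu>)"
    unfolding pois_pair_expectation_bounded[OF f B] H_def by simp
  finally show ?thesis .
qed

lemma compound_poisson_stein:
  assumes variance: "l * expectation (\<lambda>\<omega>. (X 1 \<omega>)\<^sup>2) = 1"
  shows "compound_poisson_stein \<mu> (distr (pois \<Otimes>\<^sub>M M) borel W) l"
proof -
  interpret P: pair_prob_space pois M by (rule pair_prob_space_pois)
  have iW: "integrable (pois \<Otimes>\<^sub>M M) W"
    by (rule P.P.square_integrable_imp_integrable[OF borel_measurable_W pois_pair_integrable_sq])
  \<comment> \<open>The inequality \<open>\<bar>w\<bar> \<le> (1 + w\<^sup>2) / 2\<close> with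
    second moment 1 yields \<open>abs_le_one\<close>.\<close>
  have "(\<integral>p. \<bar>W p\<bar> \<partial>(pois \<Otimes>\<^sub>M M)) \<le> (\<integral>p. (1 + (W p)\<^sup>2) / 2 \<partial>(pois \<Otimes>\<^sub>M M))"
  proof (intro integral_mono)
    show "\<bar>W p\<bar> \<le> (1 + (W p)\<^sup>2) / 2" for p
      using zero_le_power2[of "\<bar>W p\<bar> - 1"] by (simp add: power2_eq_square algebra_simps)
  qed (use iW pois_pair_integrable_sq in auto)
  also have "\<dots> = 1"
    using pois_pair_integrable_sq pois_pair_expectation_sq variance by (simp add: P.P.prob_space)
  finally have abs: "(\<integral>p. \<bar>W p\<bar> \<partial>(pois \<Otimes>\<^sub>M M)) \<le> 1" .
  interpret \<mu>: prob_space \<mu> by (rule prob_space_mu)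
  interpret \<nu>: prob_space "distr (pois \<Otimes>\<^sub>M M) borel W" by (rule P.P.prob_space_distr) measurable
  show ?thesis
  proof unfold_locales
    show "integrable \<mu> (\<lambda>x. x\<^sup>2)" "(\<integral>x. x \<partial>\<mu>) = 0" "l * (\<integral>x. x\<^sup>2 \<partial>\<mu>) = 1"
      using integrable_X1_sq mean_X1 variance by (simp_all add: integrable_distr_eq integral_distr)
    show "integrable (distr (pois \<Otimes>\<^sub>M M) borel W) (\<lambda>w. \<bar>w\<bar>)"
      "(\<integral>w. \<bar>w\<bar> \<partial>distr (pois \<Otimes>\<^sub>M M) borel W) \<le> 1"
      using iW abs by (simp_all add: integrable_distr_eq integral_distr)
    show "(\<integral>w. w * f w \<partial>distr (pois \<Otimes>\<^sub>M M) borel W) =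
        l * (\<integral>x. x * (\<integral>w. f (w + x) \<partial>distr (pois \<Otimes>\<^sub>M M) borel W) \<partial>\<mu>)"
      if [measurable]: "f \<in> borel_measurable borel" and "\<And>w. \<bar>f w\<bar> \<le> B" for f and B :: real
      using pois_pair_stein_identity[OF that] by (simp add: integral_distr)
  qed (use l_pos in auto)
qed

lemma compound_poisson_normal_approximation:
  assumes variance: "l * expectation (\<lambda>\<omega>. (X 1 \<omega>)\<^sup>2) = 1" and "a \<le> b"
  shows "\<bar>(LINT k|pois. prob {\<omega> \<in> space M. S k \<omega> \<in> {a..b}}) - (std_Phi b - std_Phi a)\<bar>
    \<le> 7.4184 * (l * expectation (\<lambda>\<omega>. (X 1 \<omega>)\<^sup>2 * min 1 \<bar>X 1 \<omega>\<bar>))"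
proof -
  interpret P: pair_prob_space pois M by (rule pair_prob_space_pois)
  interpret C: compound_poisson_stein \<mu> "distr (pois \<Otimes>\<^sub>M M) borel W" l
    by (rule compound_poisson_stein[OF variance])
  have "measure (distr (pois \<Otimes>\<^sub>M M) borel W) {a..b} = (\<integral>w. indicator {a..b} w \<partial>distr (pois \<Otimes>\<^sub>M M) borel W)"
    by simp
  also have "\<dots> = (\<integral>p. indicator {a..b} (W p + 0) \<partial>(pois \<Otimes>\<^sub>M M))"
    by (subst integral_distr) auto
  also have "\<dots> = (LINT k|pois. expectation (\<lambda>\<omega>. indicator {a..b} (S k \<omega> + 0)))"
    by (rule pois_pair_expectation_bounded[where B = 1]) auto
  also have "\<dots> = (LINT k|pois. prob {\<omega> \<in> space M. S k \<omega> \<in> {a..b}})"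
  proof (intro Bochner_Integration.integral_cong refl)
    fix k
    have "expectation (\<lambda>\<omega>. indicat_real {a..b} (S k \<omega> + 0)) =
        expectation (indicator {\<omega> \<in> space M. S k \<omega> \<in> {a..b}})"
      by (intro Bochner_Integration.integral_cong) (auto simp: indicator_def)
    then show "expectation (\<lambda>\<omega>. indicator {a..b} (S k \<omega> + 0)) = prob {\<omega> \<in> space M. S k \<omega> \<in> {a..b}}"
      by simp
  qed
  finally have "measure (distr (pois \<Otimes>\<^sub>M M) borel W) {a..b} = \<dots>" .
  moreover have "C.\<gamma> = l * expectation (\<lambda>\<omega>. (X 1 \<omega>)\<^sup>2 * min 1 \<bar>X 1 \<omega>\<bar>)"
    unfolding C.\<gamma>_def by (simp add: integral_distr)
  ultimately show ?thesis using C.normal_approximation[OF \<open>a \<le> b\<close>] by simp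
qed

end

end

subsection \<open>Mixing over the Poisson parameter\<close>

lemma folded_normal_cdf_nonneg_arg: "x \<ge> 0 \<Longrightarrow> folded_normal_cdf x = 2 * std_Phi x - 1"
  by (simp add: folded_normal_cdf_def std_normal_cdf_def)

lemma borel_measurable_folded_normal_cdf [measurable]: "folded_normal_cdf \<in> borel_measurable borel"
  unfolding folded_normal_cdf_def[abs_def] std_normal_cdf_def by measurable

lemma abs_folded_normal_cdf_le: "\<bar>folded_normal_cdf x\<bar> \<le> 1"
  using std_Phi_bounds[of x] by (auto simp: folded_normal_cdf_def std_normal_cdf_def)

text \<open>Dividing the summands by \<open>\<sigma> * sqrt l\<close> gives the normalisation
  \<open>l\<close> times variance equal to 1; the factor \<open>l\<close> then cancels against the
  squared scale and leaves \<open>1 / \<sigma>\<^sup>2\<close>.\<close>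

lemma (in iid_centered) compound_poisson_normal_approximation_scaled:
  assumes l: "l > 0" and \<sigma>: "\<sigma> > 0" "expectation (\<lambda>\<omega>. (X 1 \<omega>)\<^sup>2) = \<sigma>\<^sup>2" and "a \<le> b"
  shows "\<bar>(LINT k|poisson_pmf l. prob {\<omega> \<in> space M. S k \<omega> \<in> {a..b}})
      - (std_Phi (b / (\<sigma> * sqrt l)) - std_Phi (a / (\<sigma> * sqrt l)))\<bar>
    \<le> 7.4184 / \<sigma>\<^sup>2 * expectation (\<lambda>\<omega>. (X 1 \<omega>)\<^sup>2 * min 1 (\<bar>X 1 \<omega>\<bar> / (\<sigma> * sqrt l)))"
proof -
  define s where "s = \<sigma> * sqrt l"
  have s: "s > 0" "s\<^sup>2 = \<sigma>\<^sup>2 * l" using l \<sigma> by (simp_all add: s_def power_mult_distrib)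
  interpret Y: iid_centered M "\<lambda>i \<omega>. X i \<omega> / s"
  proof unfold_locales
    show "indep_vars (\<lambda>_. borel) (\<lambda>i \<omega>. X i \<omega> / s) {1..}"
      by (rule indep_vars_compose2[OF indep]) simp
    show "distr M borel (\<lambda>\<omega>. X i \<omega> / s) = distr M borel (\<lambda>\<omega>. X 1 \<omega> / s)" if i: "i \<ge> 1" for i
    proof -
      have "distr M borel (\<lambda>\<omega>. X i \<omega> / s) = distr (distr M borel (X i)) borel (\<lambda>x. x / s)" if "i \<ge> 1" for i
        using random_variable_X[OF that] by (subst distr_distr) (auto simp: comp_def)
      from this[OF i] this[of 1] ident[OF i] show ?thesis by simp
    qed
  qed (use integrable_X1_sq mean_X1 in \<open>simp_all add: power_divide\<close>)
  have SY: "Y.S k \<omega> = S k \<omega> / s" for k \<omega>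
    by (simp add: Y.S_def S_def sum_divide_distrib)
  have iff: "S k \<omega> / s \<in> {a / s..b / s} \<longleftrightarrow> S k \<omega> \<in> {a..b}" for k \<omega>
    using s by (simp add: divide_le_cancel)
  have var: "l * expectation (\<lambda>\<omega>. (X 1 \<omega> / s)\<^sup>2) = 1"
    using l \<sigma> s by (simp add: power_divide)
  have eq: "l * expectation (\<lambda>\<omega>. (X 1 \<omega> / s)\<^sup>2 * min 1 \<bar>X 1 \<omega> / s\<bar>)
      = expectation (\<lambda>\<omega>. (X 1 \<omega>)\<^sup>2 * min 1 (\<bar>X 1 \<omega>\<bar> / s)) / \<sigma>\<^sup>2"
    using l \<sigma> s by (simp add: power_divide)
  show ?thesis
    using Y.compound_poisson_normal_approximation[OF l var, of "a / s" "b / s"] s \<open>a \<le> b\<close>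
    unfolding SY iff eq by (simp add: divide_right_mono s_def)
qed

locale mixed_poisson_sum = iid_centered M X for M :: "'a measure" and X +
  fixes \<sigma> :: real and L :: "'a \<Rightarrow> real" and N :: "'a \<Rightarrow> nat"
  assumes sigma_pos: "\<sigma> > 0" and variance: "expectation (\<lambda>\<omega>. (X 1 \<omega>)\<^sup>2) = \<sigma>\<^sup>2"
    and L_measurable [measurable]: "L \<in> borel_measurable M"
    and L_pos: "AE \<omega> in M. L \<omega> > 0"
    and N_law: "mixed_poisson M N L"
    and N_indep: "indep_var_het M (count_space UNIV) N (\<Pi>\<^sub>M i\<in>{1..}. borel) (\<lambda>\<omega>. \<lambda>i\<in>{1..}. X i \<omega>)"
begin

abbreviation "PL \<equiv> distr M borel L"

lemma prob_space_PL: "prob_space PL"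
  by (rule prob_space_distr) measurable

lemma AE_PL_pos: "AE l in PL. l > 0"
  using L_pos by (simp add: AE_distr_iff)

lemma set_integral_PL:
  "g \<in> borel_measurable borel \<Longrightarrow> (LINT l:{0<..}|PL. g l) = (\<integral>l. g l \<partial>PL)" for g :: "real \<Rightarrow> real"
  unfolding set_lebesgue_integral_def using AE_PL_pos by (intro integral_cong_AE) auto

lemma N_measurable [measurable]: "N \<in> measurable M (count_space UNIV)"
  using N_law by (simp add: mixed_poisson_def)

lemma prob_N: "prob {\<omega> \<in> space M. N \<omega> = k} = (\<integral>l. exp (- l) * l ^ k / fact k \<partial>PL)"
  using N_law set_integral_PL[of "\<lambda>l. exp (- l) * l ^ k / fact k"] by (simp add: mixed_poisson_def)

text \<open>Independence is given for the whole sequence, so the event about \<open>S k\<close> is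
  expressed as the preimage of the cylinder set \<open>?C\<close> of sequences whose first
  \<open>k\<close> terms sum into \<open>A\<close>.\<close>

lemma prob_N_S:
  assumes [measurable]: "A \<in> sets borel"
  shows "prob {\<omega> \<in> space M. N \<omega> = k \<and> S k \<omega> \<in> A} =
    prob {\<omega> \<in> space M. N \<omega> = k} * prob {\<omega> \<in> space M. S k \<omega> \<in> A}"
proof -
  let ?P = "\<Pi>\<^sub>M i\<in>{1::nat..}. (borel :: real measure)" and ?X = "\<lambda>\<omega>. \<lambda>i\<in>{1..}. X i \<omega>"
  let ?C = "{f \<in> space ?P. (\<Sum>i=1..k. f i) \<in> A}"
  have [measurable]: "(\<lambda>f. \<Sum>i=1..k. f i) \<in> borel_measurable ?P"
    by (intro borel_measurable_sum measurable_component_singleton) auto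
  have C: "?C \<in> sets ?P" by measurable
  have ind: "indep_set (sigma_sets (space M) {N -` C \<inter> space M | C. C \<in> sets (count_space UNIV)})
     (sigma_sets (space M) {?X -` C \<inter> space M | C. C \<in> sets ?P})"
    and X: "?X \<in> measurable M ?P"
    using N_indep unfolding indep_var_het_def by auto
  have "N -` {k} \<inter> space M \<in> sigma_sets (space M) {N -` C \<inter> space M | C. C \<in> sets (count_space UNIV)}"
    by (rule sigma_sets.Basic) auto
  moreover have "?X -` ?C \<inter> space M \<in> sigma_sets (space M) {?X -` C \<inter> space M | C. C \<in> sets ?P}"
    by (rule sigma_sets.Basic) (use C in blast)
  ultimately have "prob ((N -` {k} \<inter> space M) \<inter> (?X -` ?C \<inter> space M)) =
      prob (N -` {k} \<inter> space M) * prob (?X -` ?C \<inter> space M)"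
    by (rule indep_setD[OF ind])
  moreover have "?X -` ?C \<inter> space M = {\<omega> \<in> space M. S k \<omega> \<in> A}"
    using measurable_space[OF X] by (auto simp: S_def)
  moreover have "N -` {k} \<inter> space M = {\<omega> \<in> space M. N \<omega> = k}" by auto
  moreover have "{\<omega> \<in> space M. N \<omega> = k} \<inter> {\<omega> \<in> space M. S k \<omega> \<in> A} = {\<omega> \<in> space M. N \<omega> = k \<and> S k \<omega> \<in> A}"
    by auto
  ultimately show ?thesis by simp
qed

text \<open>A series rather than an expectation under \<^const>\<open>poisson_pmf\<close>, so that it is measurable in \<open>l\<close> on all of \<open>\<real>\<close> (\<^const>\<open>poisson_pmf\<close> is specified only for \<open>l > 0\<close>).\<close>

definition \<pi> :: "real set \<Rightarrow> real \<Rightarrow> real" where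
  "\<pi> A l = (\<Sum>k. exp (- l) * l ^ k / fact k * prob {\<omega> \<in> space M. S k \<omega> \<in> A})"

lemma borel_measurable_pi [measurable]: "\<pi> A \<in> borel_measurable borel"
  unfolding \<pi>_def[abs_def] by measurable

lemma pi_eq:
  assumes l: "l > 0"
  shows "summable (\<lambda>k. exp (- l) * l ^ k / fact k * prob {\<omega> \<in> space M. S k \<omega> \<in> A})"
    and "\<pi> A l = (LINT k|poisson_pmf l. prob {\<omega> \<in> space M. S k \<omega> \<in> A})"
proof -
  have "(\<lambda>k. l ^ k / fact k * exp (- l) * prob {\<omega> \<in> space M. S k \<omega> \<in> A}) sums
      (LINT k|poisson_pmf l. prob {\<omega> \<in> space M. S k \<omega> \<in> A})"
    by (intro integral_poisson_sums(2) summable_poisson_bounded[of _ _ 1] l) auto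
  then have s: "(\<lambda>k. exp (- l) * l ^ k / fact k * prob {\<omega> \<in> space M. S k \<omega> \<in> A}) sums
      (LINT k|poisson_pmf l. prob {\<omega> \<in> space M. S k \<omega> \<in> A})"
    by (simp add: mult_ac)
  then show "summable (\<lambda>k. exp (- l) * l ^ k / fact k * prob {\<omega> \<in> space M. S k \<omega> \<in> A})"
    and "\<pi> A l = (LINT k|poisson_pmf l. prob {\<omega> \<in> space M. S k \<omega> \<in> A})"
    unfolding \<pi>_def by (auto simp: sums_iff)
qed

lemma pi_bounds:
  assumes l: "l > 0"
  shows "0 \<le> \<pi> A l" "\<pi> A l \<le> 1"
proof -
  have "integrable (poisson_pmf l) (\<lambda>k. prob {\<omega> \<in> space M. S k \<omega> \<in> A})"
    by (intro measure_pmf.integrable_const_bound[of _ 1]) auto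
  then have "(LINT k|poisson_pmf l. prob {\<omega> \<in> space M. S k \<omega> \<in> A}) \<le> (LINT k|poisson_pmf l. 1)"
    by (intro integral_mono) auto
  then show "\<pi> A l \<le> 1" unfolding pi_eq(2)[OF l] by simp
  show "0 \<le> \<pi> A l" unfolding pi_eq(2)[OF l] by (intro integral_nonneg_AE) auto
qed

text \<open>Split by the value of \<open>N\<close>, factor by independence, insert the mixed Poisson
  weights, and exchange the series with the integral over the mixing law.\<close>

lemma prob_random_sum:
  assumes A[measurable]: "A \<in> sets borel"
  shows "prob {\<omega> \<in> space M. random_sum X N \<omega> \<in> A} = (\<integral>l. \<pi> A l \<partial>PL)"
proof -
  interpret PL: prob_space PL by (rule prob_space_PL)
  let ?E = "\<lambda>k. {\<omega> \<in> space M. N \<omega> = k \<and> S k \<omega> \<in> A}"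
  let ?q = "\<lambda>k. prob {\<omega> \<in> space M. S k \<omega> \<in> A}"
  let ?w = "\<lambda>k l. exp (- l) * l ^ k / fact k :: real"
  have union: "{\<omega> \<in> space M. random_sum X N \<omega> \<in> A} = (\<Union>k. ?E k)"
    by (auto simp: random_sum_def S_def)
  have sums: "(\<lambda>k. prob (?E k)) sums prob {\<omega> \<in> space M. random_sum X N \<omega> \<in> A}"
    unfolding union by (rule finite_measure_UNION) (auto simp: disjoint_family_on_def)
  have w_int: "integrable PL (?w k)" for k
  proof (rule PL.integrable_const_bound[of _ 1])
    show "AE l in PL. norm (?w k l) \<le> 1"
      using AE_PL_pos
    proof eventually_elim
      case (elim l)
      then have "pmf (poisson_pmf l) k \<le> 1" by (intro pmf_le_1)
      with elim show ?case by (simp add: mult_ac)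
    qed
  qed simp
  have term_eq: "prob (?E k) = (\<integral>l. ?w k l * ?q k \<partial>PL)" for k
    using prob_N_S[OF A, of k] prob_N[of k] by simp
  have "(\<lambda>k. \<integral>l. ?w k l * ?q k \<partial>PL) sums (\<integral>l. (\<Sum>k. ?w k l * ?q k) \<partial>PL)"
  proof (rule sums_integral)
    show "integrable PL (\<lambda>l. ?w k l * ?q k)" for k by (intro integrable_mult_left w_int)
    show "AE l in PL. summable (\<lambda>k. norm (?w k l * ?q k))"
      using AE_PL_pos by eventually_elim (use pi_eq(1) in \<open>simp add: abs_mult\<close>)
    \<comment> \<open>The terms are almost everywhere nonnegative, so their integrals are
      probabilities of disjoint events; this gives the summability that justifies the
      exchange.\<close>
    have "(\<integral>l. norm (?w k l * ?q k) \<partial>PL) = prob (?E k)" for k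
      unfolding term_eq
    proof (rule integral_cong_AE)
      show "AE l in PL. norm (?w k l * ?q k) = ?w k l * ?q k"
        using AE_PL_pos by eventually_elim simp
    qed simp_all
    then show "summable (\<lambda>k. \<integral>l. norm (?w k l * ?q k) \<partial>PL)" using sums by (simp add: sums_iff)
  qed
  with sums show ?thesis unfolding term_eq \<pi>_def by (rule sums_unique2)
qed

section \<open>The error bound as a mean under the product of the marginal laws\<close>

definition K :: "real \<Rightarrow> real \<Rightarrow> real" where "K x l = x\<^sup>2 * min 1 (\<bar>x\<bar> / (\<sigma> * sqrt l))"

lemma borel_measurable_K [measurable]: "(\<lambda>p. K (fst p) (snd p)) \<in> borel_measurable (borel \<Otimes>\<^sub>M borel)"
  unfolding K_def[abs_def] by measurable

lemma K_bounds: "l > 0 \<Longrightarrow> 0 \<le> K x l" "l > 0 \<Longrightarrow> K x l \<le> x\<^sup>2"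
  using sigma_pos by (auto simp: K_def intro!: mult_left_le)

text \<open>The integrable function \<open>x\<^sup>2\<close> dominates, and the mixing law charges
  only positive \<open>l\<close>. Stated for general \<open>h\<close> to serve \<open>K\<close> and
  both pieces into which it is split.\<close>

lemma pair_integrable:
  assumes [measurable]: "(\<lambda>p. h (fst p) (snd p)) \<in> borel_measurable (borel \<Otimes>\<^sub>M borel)"
    and bound: "\<forall>x l. l > 0 \<longrightarrow> \<bar>h x l\<bar> \<le> (x\<^sup>2 :: real)"
  shows "integrable (\<mu> \<Otimes>\<^sub>M PL) (\<lambda>p. h (fst p) (snd p))" and "integrable PL (h x)"
    and "indep_mean M (X 1) L h = (\<integral>x. (\<integral>l. h x l \<partial>PL) \<partial>\<mu>)"
proof -
  interpret \<mu>: prob_space \<mu> by (rule prob_space_mu)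
  interpret PL: prob_space PL by (rule prob_space_PL)
  interpret P: pair_prob_space \<mu> PL ..
  have h[measurable]: "h x \<in> borel_measurable borel" for x
    using measurable_compose[OF measurable_Pair1'[of x borel borel] assms(1)] by simp
  have i: "integrable PL (h x)" for x
    using AE_PL_pos bound by (intro PL.integrable_const_bound[of _ "x\<^sup>2"]) auto
  show pi: "integrable (\<mu> \<Otimes>\<^sub>M PL) (\<lambda>p. h (fst p) (snd p))"
  proof (rule P.Fubini_integrable)
    show "integrable \<mu> (\<lambda>x. \<integral>l. norm (h (fst (x, l)) (snd (x, l))) \<partial>PL)"
    proof (rule Bochner_Integration.integrable_bound[of \<mu> "\<lambda>x. x\<^sup>2"])
      show "integrable \<mu> (\<lambda>x. x\<^sup>2)" using integrable_X1_sq by (simp add: integrable_distr_eq)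
      have "(\<integral>l. \<bar>h x l\<bar> \<partial>PL) \<le> (\<integral>l. x\<^sup>2 \<partial>PL)" for x
        using AE_PL_pos bound i by (intro integral_mono_AE) auto
      then show "AE x in \<mu>. norm (\<integral>l. norm (h (fst (x, l)) (snd (x, l))) \<partial>PL) \<le> norm (x\<^sup>2)"
        using PL.prob_space by simp
    qed measurable
  qed (use i in auto)
  show "integrable PL (h x)" by (rule i)
  show "indep_mean M (X 1) L h = (\<integral>x. (\<integral>l. h x l \<partial>PL) \<partial>\<mu>)"
    unfolding indep_mean_def using P.integral_fst'[OF pi] by simp
qed

lemmas K_pair_integrable = pair_integrable[of K, OF borel_measurable_K]

lemma K_abs: "\<forall>x l. l > 0 \<longrightarrow> \<bar>K x l\<bar> \<le> x\<^sup>2"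
  using K_bounds by simp

lemma trunc_mean_eq_indep_mean:
  "(\<integral>\<omega>. (X 1 \<omega>)\<^sup>2 * trunc_mean M \<sigma> L (X 1 \<omega>) \<partial>M) = indep_mean M (X 1) L K"
proof -
  interpret PL: prob_space PL by (rule prob_space_PL)
  have "trunc_mean M \<sigma> L x = (\<integral>l. min 1 (\<bar>x\<bar> / (\<sigma> * sqrt l)) \<partial>PL)" for x
    unfolding trunc_mean_def by (subst integral_distr) auto
  then have eq: "(\<integral>l. K x l \<partial>PL) = x\<^sup>2 * trunc_mean M \<sigma> L x" for x
    by (simp add: K_def)
  have [measurable]: "(\<lambda>x. \<integral>l. K x l \<partial>PL) \<in> borel_measurable borel"
    unfolding K_def by measurable
  have "indep_mean M (X 1) L K = (\<integral>x. (\<integral>l. K x l \<partial>PL) \<partial>\<mu>)"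
    by (rule K_pair_integrable(3)[OF K_abs])
  also have "\<dots> = (\<integral>\<omega>. (\<integral>l. K (X 1 \<omega>) l \<partial>PL) \<partial>M)"
    by (rule integral_distr) measurable
  finally show ?thesis unfolding eq by simp
qed

text \<open>The minimum in \<open>K\<close> is 1 in the first case and the quotient in the second,
  where \<open>x\<^sup>2 * \<bar>x\<bar>\<close> is the cube. Both pieces are nonnegative and hence
  dominated by \<open>K\<close>.\<close>

lemma indep_mean_split:
  "indep_mean M (X 1) L K =
     indep_mean M (X 1) L (\<lambda>x l. x\<^sup>2 * (if \<bar>x\<bar> \<ge> \<sigma> * sqrt l then 1 else 0)) +
     indep_mean M (X 1) L (\<lambda>x l. \<bar>x\<bar> ^ 3 / (\<sigma> * sqrt l) * (if \<bar>x\<bar> < \<sigma> * sqrt l then 1 else 0))"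
    (is "_ = indep_mean M _ L ?K1 + indep_mean M _ L ?K2")
proof -
  interpret \<mu>: prob_space \<mu> by (rule prob_space_mu)
  interpret PL: prob_space PL by (rule prob_space_PL)
  interpret P: pair_prob_space \<mu> PL ..
  have m: "(\<lambda>p. ?K1 (fst p) (snd p)) \<in> borel_measurable (borel \<Otimes>\<^sub>M borel)"
    "(\<lambda>p. ?K2 (fst p) (snd p)) \<in> borel_measurable (borel \<Otimes>\<^sub>M borel)"
    by measurable
  have split: "K x l = ?K1 x l + ?K2 x l" and nonneg: "0 \<le> ?K1 x l" "0 \<le> ?K2 x l" if "l > 0" for x l
  proof -
    have s: "\<sigma> * sqrt l > 0" using that sigma_pos by simp
    have "\<bar>x\<bar> ^ 3 = x\<^sup>2 * \<bar>x\<bar>" by (simp add: power2_eq_square power3_eq_cube)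
    with s show "K x l = ?K1 x l + ?K2 x l"
      unfolding K_def min_def by (auto simp: pos_le_divide_eq)
    show "0 \<le> ?K1 x l" "0 \<le> ?K2 x l" using s by simp_all
  qed
  have b: "\<forall>x l. l > 0 \<longrightarrow> \<bar>?K1 x l\<bar> \<le> x\<^sup>2" "\<forall>x l. l > 0 \<longrightarrow> \<bar>?K2 x l\<bar> \<le> x\<^sup>2"
  proof -
    have "\<bar>?K1 x l\<bar> \<le> x\<^sup>2 \<and> \<bar>?K2 x l\<bar> \<le> x\<^sup>2" if "l > 0" for x l
      using split[OF that, of x] nonneg[OF that, of x] K_bounds(2)[OF that, of x] by linarith
    then show "\<forall>x l. l > 0 \<longrightarrow> \<bar>?K1 x l\<bar> \<le> x\<^sup>2" "\<forall>x l. l > 0 \<longrightarrow> \<bar>?K2 x l\<bar> \<le> x\<^sup>2" by blast+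
  qed
  note 1 = pair_integrable[of ?K1, OF m(1) b(1)] and 2 = pair_integrable[of ?K2, OF m(2) b(2)]
  have "(\<integral>l. K x l \<partial>PL) = (\<integral>l. ?K1 x l \<partial>PL) + (\<integral>l. ?K2 x l \<partial>PL)" for x
  proof -
    have "(\<integral>l. K x l \<partial>PL) = (\<integral>l. ?K1 x l + ?K2 x l \<partial>PL)"
    proof (rule integral_cong_AE)
      show "AE l in PL. K x l = ?K1 x l + ?K2 x l"
        using AE_PL_pos by eventually_elim (rule split)
    qed (simp_all add: K_def)
    then show ?thesis using Bochner_Integration.integral_add[OF 1(2) 2(2)] by simp
  qed
  then have "indep_mean M (X 1) L K = (\<integral>x. (\<integral>l. ?K1 x l \<partial>PL) + (\<integral>l. ?K2 x l \<partial>PL) \<partial>\<mu>)"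
    using K_pair_integrable(3)[OF K_abs] by simp
  also have "\<dots> = (\<integral>x. (\<integral>l. ?K1 x l \<partial>PL) \<partial>\<mu>) + (\<integral>x. (\<integral>l. ?K2 x l \<partial>PL) \<partial>\<mu>)"
    using P.integrable_fst'[OF 1(1)] P.integrable_fst'[OF 2(1)]
    unfolding fst_conv snd_conv by (rule Bochner_Integration.integral_add)
  also have "\<dots> = indep_mean M (X 1) L ?K1 + indep_mean M (X 1) L ?K2"
    using 1(3) 2(3) by argo
  finally show ?thesis .
qed

section \<open>From a fixed rate to the mixed sum and its concentration function\<close>

lemma prob_interval_approximation:
  assumes z: "z \<ge> 0"
  shows "\<bar>prob {\<omega> \<in> space M. x \<le> random_sum X N \<omega> \<and> random_sum X N \<omega> \<le> x + z}
      - (\<integral>l. std_Phi ((x + z) / (\<sigma> * sqrt l)) - std_Phi (x / (\<sigma> * sqrt l)) \<partial>PL)\<bar>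
    \<le> 7.4184 / \<sigma>\<^sup>2 * indep_mean M (X 1) L K" (is "\<bar>_ - (\<integral>l. ?\<Delta> l \<partial>PL)\<bar> \<le> _")
proof -
  interpret \<mu>: prob_space \<mu> by (rule prob_space_mu)
  interpret PL: prob_space PL by (rule prob_space_PL)
  interpret P: pair_prob_space \<mu> PL ..
  let ?A = "{x..x + z}"
  define C where "C l = 7.4184 / \<sigma>\<^sup>2 * (\<integral>x. K x l \<partial>\<mu>)" for l
  have \<Delta>_int: "integrable PL ?\<Delta>"
  proof (rule PL.integrable_const_bound[of _ 1])
    show "AE l in PL. norm (?\<Delta> l) \<le> 1"
    proof (rule AE_I2)
      show "norm (?\<Delta> l) \<le> 1" for l
        using std_Phi_bounds[of "(x + z) / (\<sigma> * sqrt l)"] std_Phi_bounds[of "x / (\<sigma> * sqrt l)"] by auto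
    qed
  qed measurable
  have \<pi>_int: "integrable PL (\<pi> ?A)"
    using AE_PL_pos pi_bounds by (intro PL.integrable_const_bound[of _ 1]) auto
  have K_int: "integrable (\<mu> \<Otimes>\<^sub>M PL) (\<lambda>(x, l). K x l)"
    using K_pair_integrable(1)[OF K_abs] by (simp add: case_prod_beta')
  have C_int: "integrable PL C"
    unfolding C_def using P.integrable_snd[OF K_int] by simp
  have "AE l in PL. \<bar>\<pi> ?A l - ?\<Delta> l\<bar> \<le> C l"
    using AE_PL_pos
  proof eventually_elim
    case (elim l)
    have "expectation (\<lambda>\<omega>. (X 1 \<omega>)\<^sup>2 * min 1 (\<bar>X 1 \<omega>\<bar> / (\<sigma> * sqrt l))) = (\<integral>x. K x l \<partial>\<mu>)"
      unfolding K_def by (subst integral_distr) auto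
    then show ?case
      using compound_poisson_normal_approximation_scaled[OF elim sigma_pos variance, of x "x + z"] z
      by (simp add: pi_eq(2)[OF elim] C_def)
  qed
  note bound = this
  have "prob {\<omega> \<in> space M. x \<le> random_sum X N \<omega> \<and> random_sum X N \<omega> \<le> x + z} - (\<integral>l. ?\<Delta> l \<partial>PL)
      = (\<integral>l. \<pi> ?A l - ?\<Delta> l \<partial>PL)"
    using prob_random_sum[of ?A] \<Delta>_int \<pi>_int by simp
  moreover have "\<bar>\<integral>l. \<pi> ?A l - ?\<Delta> l \<partial>PL\<bar> \<le> (\<integral>l. \<bar>\<pi> ?A l - ?\<Delta> l\<bar> \<partial>PL)"
    using integral_norm_bound[of PL "\<lambda>l. \<pi> ?A l - ?\<Delta> l"] by simp
  moreover have "(\<integral>l. \<bar>\<pi> ?A l - ?\<Delta> l\<bar> \<partial>PL) \<le> (\<integral>l. C l \<partial>PL)"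
    by (intro integral_mono_AE bound Bochner_Integration.integrable_abs
        Bochner_Integration.integrable_diff \<Delta>_int \<pi>_int C_int)
  \<comment> \<open>\<open>C\<close> integrates over the jump first, \<open>indep_mean\<close> was
    evaluated with the rate first; Fubini's theorem reconciles the two.\<close>
  moreover have "(\<integral>l. C l \<partial>PL) = 7.4184 / \<sigma>\<^sup>2 * indep_mean M (X 1) L K"
    using K_pair_integrable(3)[OF K_abs] P.Fubini_integral[OF K_int] by (simp add: C_def)
  ultimately show ?thesis by argo
qed

text \<open>For the upper bound every interval is compared with the centred one at each rate. For
  the lower bound the single choice \<open>x = - z / 2\<close> is optimal at all rates at once, so
  the supremum commutes with mixing up to the error.\<close>

lemma concentration_fun_approximation:
  assumes z: "z \<ge> 0"
  shows "\<bar>concentration_fun M (random_sum X N) z - (\<integral>l. folded_normal_cdf (z / (2 * \<sigma> * sqrt l)) \<partial>PL)\<bar>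
    \<le> 7.4184 / \<sigma>\<^sup>2 * indep_mean M (X 1) L K"
proof -
  interpret PL: prob_space PL by (rule prob_space_PL)
  let ?I = "\<lambda>x. prob {\<omega> \<in> space M. x \<le> random_sum X N \<omega> \<and> random_sum X N \<omega> \<le> x + z}"
  let ?\<Delta> = "\<lambda>x l. std_Phi ((x + z) / (\<sigma> * sqrt l)) - std_Phi (x / (\<sigma> * sqrt l))"
  let ?F = "\<lambda>l. folded_normal_cdf (z / (2 * \<sigma> * sqrt l))" and ?C = "7.4184 / \<sigma>\<^sup>2 * indep_mean M (X 1) L K"
  have F: "?F l = 2 * std_Phi (z / (\<sigma> * sqrt l) / 2) - 1" if "l > 0" for l
    using z sigma_pos that by (subst folded_normal_cdf_nonneg_arg) (auto simp: mult_ac)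
  have \<Delta>_le: "?\<Delta> x l \<le> ?F l" if "l > 0" for x l
    using std_normal_interval_le[of "z / (\<sigma> * sqrt l)" "x / (\<sigma> * sqrt l)"] z sigma_pos that
    unfolding F[OF that] by (simp add: add_divide_distrib)
  have \<Delta>_eq: "?\<Delta> (- z / 2) l = ?F l" if "l > 0" for l
  proof -
    have "(- z / 2 + z) / (\<sigma> * sqrt l) = z / (\<sigma> * sqrt l) / 2"
      "- z / 2 / (\<sigma> * sqrt l) = - (z / (\<sigma> * sqrt l) / 2)" by simp_all
    then show ?thesis unfolding F[OF that] by (simp only: std_Phi_minus)
  qed
  have \<Delta>_int: "integrable PL (?\<Delta> x)" for x
  proof (rule PL.integrable_const_bound[of _ 1])
    show "AE l in PL. norm (?\<Delta> x l) \<le> 1"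
    proof (rule AE_I2)
      show "norm (?\<Delta> x l) \<le> 1" for l
        using std_Phi_bounds[of "(x + z) / (\<sigma> * sqrt l)"] std_Phi_bounds[of "x / (\<sigma> * sqrt l)"] by auto
    qed
  qed measurable
  have F_int: "integrable PL ?F"
    using abs_folded_normal_cdf_le by (intro PL.integrable_const_bound[of _ 1]) auto
  have "?I x \<le> (\<integral>l. ?F l \<partial>PL) + ?C" for x
  proof -
    have "(\<integral>l. ?\<Delta> x l \<partial>PL) \<le> (\<integral>l. ?F l \<partial>PL)"
    proof (intro integral_mono_AE \<Delta>_int F_int)
      show "AE l in PL. ?\<Delta> x l \<le> ?F l" using AE_PL_pos by eventually_elim (rule \<Delta>_le)
    qed
    with prob_interval_approximation[OF z, of x] show ?thesis by linarith
  qed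
  then have upper: "concentration_fun M (random_sum X N) z \<le> (\<integral>l. ?F l \<partial>PL) + ?C"
    unfolding concentration_fun_def by (intro cSUP_least) auto
  have "(\<integral>l. ?\<Delta> (- z / 2) l \<partial>PL) = (\<integral>l. ?F l \<partial>PL)"
  proof (rule integral_cong_AE)
    show "AE l in PL. ?\<Delta> (- z / 2) l = ?F l" using AE_PL_pos by eventually_elim (rule \<Delta>_eq)
  qed measurable
  then have "(\<integral>l. ?F l \<partial>PL) - ?C \<le> ?I (- z / 2)"
    using prob_interval_approximation[OF z, of "- z / 2"] by linarith
  also have "\<dots> \<le> concentration_fun M (random_sum X N) z"
    unfolding concentration_fun_def by (rule cSUP_upper) (auto intro!: bdd_aboveI[of _ 1])
  finally show ?thesis using upper by linarith
qed

text \<open>Normalising by the mean and multiplying it back cancel. This needs a nonzero mean, which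
  holds because an integrable variable that is positive almost surely has positive
  expectation.\<close>

lemma integral_scaled_mixing_law:
  assumes int: "integrable M L"
  shows "(LINT l:{0<..}|distr M borel (\<lambda>\<omega>. L \<omega> / expectation L).
      folded_normal_cdf (z / (2 * \<sigma> * sqrt (l * expectation L))))
    = (\<integral>l. folded_normal_cdf (z / (2 * \<sigma> * sqrt l)) \<partial>PL)"
proof -
  have "expectation L \<noteq> 0"
  proof
    assume "expectation L = 0"
    moreover have "AE \<omega> in M. 0 \<le> L \<omega>" using L_pos by eventually_elim simp
    ultimately have "AE \<omega> in M. L \<omega> = 0"
      using integral_nonneg_eq_0_iff_AE[OF int] by simp
    with L_pos have "AE \<omega> in M. False" by eventually_elim simp
    then show False by simp
  qed
  moreover have "expectation L \<ge> 0" using L_pos by (intro integral_nonneg_AE) auto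
  ultimately have e: "expectation L > 0" by simp
  have "(LINT l:{0<..}|distr M borel (\<lambda>\<omega>. L \<omega> / expectation L).
      folded_normal_cdf (z / (2 * \<sigma> * sqrt (l * expectation L))))
    = (\<integral>\<omega>. indicator {0<..} (L \<omega> / expectation L) *\<^sub>R
        folded_normal_cdf (z / (2 * \<sigma> * sqrt (L \<omega> / expectation L * expectation L))) \<partial>M)"
    unfolding set_lebesgue_integral_def by (subst integral_distr) auto
  also have "\<dots> = (\<integral>\<omega>. folded_normal_cdf (z / (2 * \<sigma> * sqrt (L \<omega>))) \<partial>M)"
    using L_pos e by (intro integral_cong_AE) (auto simp: indicator_def)
  also have "\<dots> = (\<integral>l. folded_normal_cdf (z / (2 * \<sigma> * sqrt l)) \<partial>PL)"
    by (subst integral_distr) auto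
  finally show ?thesis .
qed

end

theorem theorem7:
  fixes M :: "'a measure"
    and X :: "nat \<Rightarrow> 'a \<Rightarrow> real"
    and \<sigma> :: real
    and \<Lambda> :: "nat \<Rightarrow> 'a \<Rightarrow> real"
    and N :: "nat \<Rightarrow> 'a \<Rightarrow> nat"
    and n :: nat
  assumes "prob_space M"
    and "prob_space.indep_vars M (\<lambda>_. borel) X {1..}"
    and "\<And>i. i \<ge> 1 \<Longrightarrow> distr M borel (X i) = distr M borel (X 1)"
    and "integrable M (X 1)"
    and "(\<integral>\<omega>. X 1 \<omega> \<partial>M) = 0"
    and "integrable M (\<lambda>\<omega>. (X 1 \<omega>)\<^sup>2)"
    and "(\<integral>\<omega>. (X 1 \<omega>)\<^sup>2 \<partial>M) = \<sigma>\<^sup>2"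
    and "\<sigma> > 0"
    and "\<And>m. m \<ge> 1 \<Longrightarrow> \<Lambda> m \<in> borel_measurable M"
    and "\<And>m. m \<ge> 1 \<Longrightarrow> AE \<omega> in M. \<Lambda> m \<omega> > 0"
    and "\<And>m. m \<ge> 1 \<Longrightarrow> mixed_poisson M (N m) (\<Lambda> m)"
    and "\<And>m. m \<ge> 1 \<Longrightarrow> indep_var_het M (count_space UNIV) (N m)
           (\<Pi>\<^sub>M i\<in>{1..}. borel) (\<lambda>\<omega>. \<lambda>i\<in>{1..}. X i \<omega>)"
    and "n \<ge> 1"
    and "integrable M (\<Lambda> n)"
  shows "(SUP z\<in>{0..}.
            \<bar>concentration_fun M (random_sum X (N n)) z -
             (LINT l:{0<..}|distr M borel (\<lambda>\<omega>. \<Lambda> n \<omega> / (\<integral>\<omega>'. \<Lambda> n \<omega>' \<partial>M)).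
                folded_normal_cdf (z / (2 * \<sigma> * sqrt (l * (\<integral>\<omega>'. \<Lambda> n \<omega>' \<partial>M)))))\<bar>)
           \<le> 7.4184 / \<sigma>\<^sup>2 * (\<integral>\<omega>. (X 1 \<omega>)\<^sup>2 * trunc_mean M \<sigma> (\<Lambda> n) (X 1 \<omega>) \<partial>M) \<and>
         7.4184 / \<sigma>\<^sup>2 * (\<integral>\<omega>. (X 1 \<omega>)\<^sup>2 * trunc_mean M \<sigma> (\<Lambda> n) (X 1 \<omega>) \<partial>M)
           = 7.4184 / \<sigma>\<^sup>2 *
               indep_mean M (X 1) (\<Lambda> n) (\<lambda>x l. x\<^sup>2 * min 1 (\<bar>x\<bar> / (\<sigma> * sqrt l))) \<and>
         7.4184 / \<sigma>\<^sup>2 *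
             indep_mean M (X 1) (\<Lambda> n) (\<lambda>x l. x\<^sup>2 * min 1 (\<bar>x\<bar> / (\<sigma> * sqrt l)))
           = 7.4184 / \<sigma>\<^sup>2 *
               (indep_mean M (X 1) (\<Lambda> n)
                  (\<lambda>x l. x\<^sup>2 * (if \<bar>x\<bar> \<ge> \<sigma> * sqrt l then 1 else 0)) +
                indep_mean M (X 1) (\<Lambda> n)
                  (\<lambda>x l. \<bar>x\<bar> ^ 3 / (\<sigma> * sqrt l) * (if \<bar>x\<bar> < \<sigma> * sqrt l then 1 else 0)))"
proof -
  have "mixed_poisson_sum M X \<sigma> (\<Lambda> n) (N n)"
    by (intro mixed_poisson_sum.intro iid_centered.intro iid_centered_axioms.intro
        mixed_poisson_sum_axioms.intro assms(1-3,5-8) assms(9-12)[OF assms(13)])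
  then interpret mixed_poisson_sum M X \<sigma> "\<Lambda> n" "N n" .
  have K: "(\<lambda>x l. x\<^sup>2 * min 1 (\<bar>x\<bar> / (\<sigma> * sqrt l))) = K"
    by (simp add: K_def fun_eq_iff)
  \<comment> \<open>The error bound does not depend on \<open>z\<close>, so it passes to the
    supremum.\<close>
  have "(SUP z\<in>{0..}. \<bar>concentration_fun M (random_sum X (N n)) z -
      (\<integral>l. folded_normal_cdf (z / (2 * \<sigma> * sqrt l)) \<partial>PL)\<bar>)
    \<le> 7.4184 / \<sigma>\<^sup>2 * indep_mean M (X 1) (\<Lambda> n) K"
    by (intro cSUP_least concentration_fun_approximation) auto
  then show ?thesis
    unfolding K trunc_mean_eq_indep_mean integral_scaled_mixing_law[OF assms(14)] indep_mean_split[symmetric]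
    by blast
qed

end
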